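(* Let $G=G^{str}\cup G^{def}$ be a defeasible graph and let $\langle p,\mathsf{sp},q\rangle$ be a defeasible triple. Then $G\models_{\min}\langle p,\mathsf{sp},q\rangle$ if and only if the procedure $\mathtt{DefMinEntailmentP}(G,\mathrm{r}(G),\langle p,\mathsf{sp},q\rangle)$ returns true, where $\mathrm{r}(G)$ is the output of $\mathtt{Ranking}(G)$.
   Context: **Syntax.** $U$ (URI references) and $L$ (literals, plain or typed) are disjoint sets; terms are the elements of $UL=U\cup L$. $\rho df_\bot=\{\mathsf{sp},\mathsf{sc},\mathsf{type},\mathsf{dom},\mathsf{range},\bot_c,\bot_p\}\subseteq U$. A ($\rho df_\bot$-)triple is $(s,p,o)\in UL\times U\times UL$ with $s,o\notin\rho df_\bot$; a graph is a finite set of triples; $\mathrm{uni}(G)$ is the set of terms occurring in it. A defeasible triple is $\langle s,p,o\rangle$ with $p\in\{\mathsf{sc},\mathsf{sp}\}$, $s,o\in UL\setminus\rho df_\bot$. A defeasible graph is $G=G^{str}\cup G^{def}$ with $G^{str}$ a graph and $G^{def}$ a finite set of defeasible triples. For a set $D$ of defeasible triples $D^s=\{(s,p,o):\langle s,p,o\rangle\in D\}$; $G^s=G^{str}\cup(G^{def})^s$. **Derivation.** Rules (metavariables range over $UL$): (2a) $(A,\mathsf{sp},B),(B,\mathsf{sp},C)\Rightarrow(A,\mathsf{sp},C)$; (2b) $(D,\mathsf{sp},E),(X,D,Y)\Rightarrow(X,E,Y)$; (3a) $(A,\mathsf{sc},B),(B,\mathsf{sc},C)\Rightarrow(A,\mathsf{sc},C)$;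 (3b) $(A,\mathsf{sc},B),(X,\mathsf{type},A)\Rightarrow(X,\mathsf{type},B)$; (4a) $(D,\mathsf{dom},B),(X,D,Y)\Rightarrow(X,\mathsf{type},B)$; (4b) $(D,\mathsf{range},B),(X,D,Y)\Rightarrow(Y,\mathsf{type},B)$; (5a) $(A,\bot_c,B)\Rightarrow(B,\bot_c,A)$; (5b) $(A,\bot_c,B),(C,\mathsf{sc},A)\Rightarrow(C,\bot_c,B)$; (5c) $(A,\bot_c,A)\Rightarrow(A,\bot_c,B)$; (6a) $(A,\bot_p,B)\Rightarrow(B,\bot_p,A)$; (6b) $(A,\bot_p,B),(C,\mathsf{sp},A)\Rightarrow(C,\bot_p,B)$; (6c) $(A,\bot_p,A)\Rightarrow(A,\bot_p,B)$; (7a) $(A,\mathsf{dom},C),(B,\mathsf{dom},D),(C,\bot_c,D)\Rightarrow(A,\bot_p,B)$; (7b) $(A,\mathsf{range},C),(B,\mathsf{range},D),(C,\bot_c,D)\Rightarrow(A,\bot_p,B)$. $\mathrm{Cl}(G)$ is the closure of $G$ under these rules; $G\vdash\tau$ means $\tau$ is derivable from $G$ by finitely many rule applications. **Interpretations.** An interpretation over $V\subseteq UL$ is $\mathcal I=\langle\Delta_R,\Delta_P,\Delta_C,\Delta_L,P[\cdot],C[\cdot],\cdot^{\mathcal I}\rangle$ with finite sets $\Delta_C\subseteq\Delta_R$, $L\cap V\subseteq\Delta_L\subseteq\Delta_R$, $\Delta_P$, maps $P:\Delta_P\to2^{\Delta_R\times\Delta_R}$, $C:\Delta_C\to2^{\Delta_R}$,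 and $\cdot^{\mathcal I}:UL\cap V\to\Delta_R\cup\Delta_P$, the identity on plain literals and mapping literals into $\Delta_R$. $\mathcal I\Vdash G$ iff $\mathcal I$ interprets (at least) $\rho df_\bot\cup\mathrm{uni}(G)$ and, writing $P_e=P[e^{\mathcal I}]$: for each $(s,p,o)\in G$, $p^{\mathcal I}\in\Delta_P$ and $(s^{\mathcal I},o^{\mathcal I})\in P[p^{\mathcal I}]$; $e^{\mathcal I}\in\Delta_P$ for $e\in\rho df_\bot$; $P_{\mathsf{sp}}$ is transitive over $\Delta_P$ and $(p,q)\in P_{\mathsf{sp}}$ implies $p,q\in\Delta_P$, $P[p]\subseteq P[q]$; $P_{\mathsf{sc}}$ is transitive over $\Delta_C$ and $(c,d)\in P_{\mathsf{sc}}$ implies $c,d\in\Delta_C$, $C[c]\subseteq C[d]$; $x\in C[c]$ iff $(x,c)\in P_{\mathsf{type}}$, and $(x,c)\in P_{\mathsf{type}}$ implies $c\in\Delta_C$; $(p,c)\in P_{\mathsf{dom}}$ (resp. $P_{\mathsf{range}}$) implies $p\in\Delta_P$, $c\in\Delta_C$ and, for all $(x,y)\in P[p]$, $x\in C[c]$ (resp. $y\in C[c]$); $P_{\bot_c}$ is a symmetric relation on $\Delta_C$ with: $(c,d)\in P_{\bot_c}$, $(e,c)\in P_{\mathsf{sc}}$ imply $(e,d)\in P_{\bot_c}$, and $(c,c)\in P_{\bot_c}$, $d\in\Delta_C$ imply $(c,d)\in P_{\bot_c}$; $P_{\bot_p}$ is a symmetric relation on $\Delta_P$ with the same two properties for $\mathsf{sp}$,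 $\Delta_P$; if $(p,c),(q,d)\in P_{\mathsf{dom}}$ (or both in $P_{\mathsf{range}}$) and $(c,d)\in P_{\bot_c}$ then $(p,q)\in P_{\bot_p}$. **Ranked models.** For a defeasible graph $G$ fix the domains $\Delta_R=\mathrm{uni}(G^s)\cup\rho df_\bot$; $\Delta_P=\rho df_\bot\cup\{p\in\mathrm{uni}(G^s):p$ is the predicate of a triple, the subject or object of an $\mathsf{sp}$- or $\bot_p$-triple, or the subject of a $\mathsf{dom}$- or $\mathsf{range}$-triple of $\mathrm{Cl}(G^s)\}$; $\Delta_C=\{c\in\mathrm{uni}(G^s):c$ is the object of a $\mathsf{type}$-, $\mathsf{dom}$- or $\mathsf{range}$-triple, or the subject or object of an $\mathsf{sc}$- or $\bot_c$-triple of $\mathrm{Cl}(G^s)\}$; $\Delta_L=\mathrm{uni}(G^s)\cap L$. Let $\mathcal M$ be the set of all interpretations over $\rho df_\bot\cup\mathrm{uni}(G^s)$ with these domains. A ranked interpretation is $\mathcal R=(\mathcal M,r)$ with $r:\mathcal M\to\mathbb N\cup\{\infty\}$ attaining $0$ and such that if $r$ attains $i\in\mathbb N$, $i>0$, it attains $i-1$. $\mathcal M_{\mathbb N}=\{\mathcal I:r(\mathcal I)<\infty\}$. $\mathrm{cmin}(t,\mathcal R)$ (resp. $\mathrm{pmin}(t,\mathcal R)$) is the set of $\mathcal I\in\mathcal M_{\mathbb N}$ of least rank among those in $\mathcal M_{\mathbb N}$ with $\mathcal I\not\Vdash(t,\bot_c,t)$ (resp. $\mathcal I\not\Vdash(t,\bot_p,t)$).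 $\mathcal R\Vdash(s,p,o)$ iff all $\mathcal I\in\mathcal M_{\mathbb N}$ satisfy it; $\mathcal R\Vdash\langle c,\mathsf{sc},d\rangle$ iff $\mathcal I\Vdash(c,\mathsf{sc},d)$ for all $\mathcal I\in\mathrm{cmin}(c,\mathcal R)$; $\mathcal R\Vdash\langle p,\mathsf{sp},q\rangle$ iff $\mathcal I\Vdash(p,\mathsf{sp},q)$ for all $\mathcal I\in\mathrm{pmin}(p,\mathcal R)$. $\mathcal R$ is a ranked model of $G$ if it satisfies every element of $G$. Put $(\mathcal M,r)\preceq(\mathcal M,r')$ iff $r\le r'$ pointwise; $G$ has a unique $\preceq$-minimal ranked model $\mathcal R_{\min G}$. $G\models_{\min}\tau$ iff $\mathcal R_{\min G}\Vdash\tau$. **Procedures.** $\mathtt{Ranking}(G)$: $D_0=G^{def}$; $D_{i+1}=\{\langle p,\mathsf{sc},q\rangle\in D_i:G^{str}\cup D_i^s\vdash(p,\bot_c,p)\}\cup\{\langle p,\mathsf{sp},q\rangle\in D_i:G^{str}\cup D_i^s\vdash(p,\bot_p,p)\}$; let $n$ be least with $D_n=D_{n+1}$, $D_\infty=D_n$; output $\mathrm{r}(G)=\{D_0,\dots,D_n,D_\infty\}$. $\mathtt{DefMinEntailmentP}(G,\mathrm{r}(G),\langle p,\mathsf{sp},q\rangle)$: set $D_{n+1}=D_\infty$. If $G^{str}\cup D_i^s\vdash(p,\bot_p,p)$ for all $0\le i\le n$, return true. Otherwise let $j\le n$ be least with $G^{str}\cup D_j^s\not\vdash(p,\bot_p,p)$,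 let $D^p$ be the set of all $\mathsf{sp}$-triples $\langle a,\mathsf{sp},b\rangle\in D_j\setminus D_{j+1}$, and return true iff $G^{str}\cup(D^p)^s\vdash(p,\mathsf{sp},q)$. *)

theory Defs
  imports Main "HOL-Library.FuncSet" "HOL-Library.Extended_Nat"
begin

section \<open>Syntax\<close>

text \<open>
  The URI references are the seven reserved constants together with the terms \<open>URI u\<close>; the
  literals are the remaining terms.  Disjointness of \<open>U\<close> and \<open>L\<close>, distinctness of the reserved
  constants and their being URI references are thus built into the type, and \<open>UL\<close> is \<open>UNIV\<close>.
\<close>

datatype ('u, 'p, 't) rdf_term =
    SP | SC | TYP | DOM | RNG | BOTC | BOTP
  | URI 'u
  | PlainLit 'p
  | TypedLit 't

type_synonym ('u, 'p, 't) triple =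
  "('u, 'p, 't) rdf_term \<times> ('u, 'p, 't) rdf_term \<times> ('u, 'p, 't) rdf_term"

definition rho_df :: "('u, 'p, 't) rdf_term set" where
  "rho_df = {SP, SC, TYP, DOM, RNG, BOTC, BOTP}"

definition plain_literals :: "('u, 'p, 't) rdf_term set" where
  "plain_literals = range PlainLit"

definition literals :: "('u, 'p, 't) rdf_term set" where
  "literals = plain_literals \<union> range TypedLit"

definition uris :: "('u, 'p, 't) rdf_term set" where
  "uris = rho_df \<union> range URI"

definition is_triple :: "('u, 'p, 't) triple \<Rightarrow> bool" where
  "is_triple = (\<lambda>(s, p, o'). p \<in> uris \<and> s \<notin> rho_df \<and> o' \<notin> rho_df)"

definition is_graph :: "('u, 'p, 't) triple set \<Rightarrow> bool" where
  "is_graph G \<longleftrightarrow> finite G \<and> (\<forall>\<tau>\<in>G. is_triple \<tau>)"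

definition uni :: "('u, 'p, 't) triple set \<Rightarrow> ('u, 'p, 't) rdf_term set" where
  "uni G = (\<Union>(s, p, o')\<in>G. {s, p, o'})"

text \<open>\<open>Strict (s, p, o)\<close> is the triple \<open>(s, p, o)\<close>, \<open>Defeasible (s, p, o)\<close> is \<open>\<langle>s, p, o\<rangle>\<close>.\<close>

datatype ('u, 'p, 't) statement =
    Strict "('u, 'p, 't) triple"
  | Defeasible "('u, 'p, 't) triple"

fun is_defeasible_triple :: "('u, 'p, 't) statement \<Rightarrow> bool" where
  "is_defeasible_triple (Strict \<tau>) \<longleftrightarrow> False"
| "is_defeasible_triple (Defeasible (s, p, o')) \<longleftrightarrow>
     p \<in> {SC, SP} \<and> s \<notin> rho_df \<and> o' \<notin> rho_df"

definition str_part :: "('u, 'p, 't) statement set \<Rightarrow> ('u, 'p, 't) triple set" where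
  "str_part G = {\<tau>. Strict \<tau> \<in> G}"

definition def_part :: "('u, 'p, 't) statement set \<Rightarrow> ('u, 'p, 't) statement set" where
  "def_part G = G \<inter> range Defeasible"

definition is_defeasible_graph :: "('u, 'p, 't) statement set \<Rightarrow> bool" where
  "is_defeasible_graph G \<longleftrightarrow>
     is_graph (str_part G) \<and> finite (def_part G) \<and> (\<forall>\<delta>\<in>def_part G. is_defeasible_triple \<delta>)"

definition strictify :: "('u, 'p, 't) statement set \<Rightarrow> ('u, 'p, 't) triple set" where
  "strictify D = {\<tau>. Defeasible \<tau> \<in> D}"

definition strict_graph :: "('u, 'p, 't) statement set \<Rightarrow> ('u, 'p, 't) triple set" where
  "strict_graph G = str_part G \<union> strictify (def_part G)"


section \<open>Derivation\<close>

inductive rho_rule :: "('u, 'p, 't) triple set \<Rightarrow> ('u, 'p, 't) triple \<Rightarrow> bool" where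
  r2a: "rho_rule {(A, SP, B), (B, SP, C)} (A, SP, C)"
| r2b: "rho_rule {(D, SP, E), (X, D, Y)} (X, E, Y)"
| r3a: "rho_rule {(A, SC, B), (B, SC, C)} (A, SC, C)"
| r3b: "rho_rule {(A, SC, B), (X, TYP, A)} (X, TYP, B)"
| r4a: "rho_rule {(D, DOM, B), (X, D, Y)} (X, TYP, B)"
| r4b: "rho_rule {(D, RNG, B), (X, D, Y)} (Y, TYP, B)"
| r5a: "rho_rule {(A, BOTC, B)} (B, BOTC, A)"
| r5b: "rho_rule {(A, BOTC, B), (C, SC, A)} (C, BOTC, B)"
| r5c: "rho_rule {(A, BOTC, A)} (A, BOTC, B)"
| r6a: "rho_rule {(A, BOTP, B)} (B, BOTP, A)"
| r6b: "rho_rule {(A, BOTP, B), (C, SP, A)} (C, BOTP, B)"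
| r6c: "rho_rule {(A, BOTP, A)} (A, BOTP, B)"
| r7a: "rho_rule {(A, DOM, C), (B, DOM, D), (C, BOTC, D)} (A, BOTP, B)"
| r7b: "rho_rule {(A, RNG, C), (B, RNG, D), (C, BOTC, D)} (A, BOTP, B)"

text \<open>
  Only triples are derived: an instance of a rule whose conclusion is not a triple (\<open>E\<close> a literal
  in \<open>r2b\<close>, or \<open>B\<close> reserved in \<open>r5c\<close>, \<open>r6c\<close>) is not applicable.
\<close>

inductive derives :: "('u, 'p, 't) triple set \<Rightarrow> ('u, 'p, 't) triple \<Rightarrow> bool"
  for G :: "('u, 'p, 't) triple set"
where
  base: "\<tau> \<in> G \<Longrightarrow> derives G \<tau>"
| step: "rho_rule T \<tau> \<Longrightarrow> is_triple \<tau> \<Longrightarrow> (\<forall>\<sigma>\<in>T. derives G \<sigma>) \<Longrightarrow> derives G \<tau>"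

definition Cl :: "('u, 'p, 't) triple set \<Rightarrow> ('u, 'p, 't) triple set" where
  "Cl G = {\<tau>. derives G \<tau>}"


section \<open>Interpretations\<close>

text \<open>
  The elements of the domains are taken from the type of the terms, since the domains that
  ranked interpretations are built on consist of terms.  The field \<open>voc\<close> is the vocabulary \<open>V\<close> over
  which the interpretation is defined; \<open>den\<close> is \<open>\<cdot>\<^sup>I\<close>.  The three maps are extensional, i.e. fixed to
  \<open>undefined\<close> outside their domains, so that they are determined by their values there.
\<close>

record 'a interp =
  voc :: "'a set"
  dR :: "'a set"
  dP :: "'a set"
  dC :: "'a set"
  dL :: "'a set"
  pext :: "'a \<Rightarrow> ('a \<times> 'a) set"
  cext :: "'a \<Rightarrow> 'a set"
  den :: "'a \<Rightarrow> 'a"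

definition is_interp ::
  "('u, 'p, 't) rdf_term set \<Rightarrow> ('u, 'p, 't) rdf_term interp \<Rightarrow> bool" where
  "is_interp V I \<longleftrightarrow>
     voc I = V \<and>
     finite (dR I) \<and> finite (dP I) \<and> finite (dC I) \<and> finite (dL I) \<and>
     dC I \<subseteq> dR I \<and> literals \<inter> V \<subseteq> dL I \<and> dL I \<subseteq> dR I \<and>
     pext I \<in> dP I \<rightarrow>\<^sub>E Pow (dR I \<times> dR I) \<and>
     cext I \<in> dC I \<rightarrow>\<^sub>E Pow (dR I) \<and>
     den I \<in> V \<rightarrow>\<^sub>E dR I \<union> dP I \<and>
     (\<forall>l \<in> plain_literals \<inter> V. den I l = l) \<and>
     (\<forall>l \<in> literals \<inter> V. den I l \<in> dR I)"

definition Pd :: "'a interp \<Rightarrow> 'a \<Rightarrow> ('a \<times> 'a) set" where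
  "Pd I e = pext I (den I e)"

definition satisfies ::
  "('u, 'p, 't) rdf_term interp \<Rightarrow> ('u, 'p, 't) triple set \<Rightarrow> bool" where
  "satisfies I G \<longleftrightarrow>
     rho_df \<union> uni G \<subseteq> voc I \<and>
     (\<forall>(s, p, o') \<in> G. den I p \<in> dP I \<and> (den I s, den I o') \<in> Pd I p) \<and>
     (\<forall>e \<in> rho_df. den I e \<in> dP I) \<and>
     trans_on (dP I) (Pd I SP) \<and>
     (\<forall>(p, q) \<in> Pd I SP. p \<in> dP I \<and> q \<in> dP I \<and> pext I p \<subseteq> pext I q) \<and>
     trans_on (dC I) (Pd I SC) \<and>
     (\<forall>(c, d) \<in> Pd I SC. c \<in> dC I \<and> d \<in> dC I \<and> cext I c \<subseteq> cext I d) \<and>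
     (\<forall>c \<in> dC I. \<forall>x. x \<in> cext I c \<longleftrightarrow> (x, c) \<in> Pd I TYP) \<and>
     (\<forall>(x, c) \<in> Pd I TYP. c \<in> dC I) \<and>
     (\<forall>(p, c) \<in> Pd I DOM. p \<in> dP I \<and> c \<in> dC I \<and> (\<forall>(x, y) \<in> pext I p. x \<in> cext I c)) \<and>
     (\<forall>(p, c) \<in> Pd I RNG. p \<in> dP I \<and> c \<in> dC I \<and> (\<forall>(x, y) \<in> pext I p. y \<in> cext I c)) \<and>
     Pd I BOTC \<subseteq> dC I \<times> dC I \<and> sym (Pd I BOTC) \<and>
     (\<forall>c d e. (c, d) \<in> Pd I BOTC \<and> (e, c) \<in> Pd I SC \<longrightarrow> (e, d) \<in> Pd I BOTC) \<and>
     (\<forall>c. \<forall>d \<in> dC I. (c, c) \<in> Pd I BOTC \<longrightarrow> (c, d) \<in> Pd I BOTC) \<and>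
     Pd I BOTP \<subseteq> dP I \<times> dP I \<and> sym (Pd I BOTP) \<and>
     (\<forall>p q e. (p, q) \<in> Pd I BOTP \<and> (e, p) \<in> Pd I SP \<longrightarrow> (e, q) \<in> Pd I BOTP) \<and>
     (\<forall>p. \<forall>q \<in> dP I. (p, p) \<in> Pd I BOTP \<longrightarrow> (p, q) \<in> Pd I BOTP) \<and>
     (\<forall>p q c d. (p, c) \<in> Pd I DOM \<and> (q, d) \<in> Pd I DOM \<and> (c, d) \<in> Pd I BOTC
        \<longrightarrow> (p, q) \<in> Pd I BOTP) \<and>
     (\<forall>p q c d. (p, c) \<in> Pd I RNG \<and> (q, d) \<in> Pd I RNG \<and> (c, d) \<in> Pd I BOTC
        \<longrightarrow> (p, q) \<in> Pd I BOTP)"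


section \<open>Ranked models\<close>

definition domR :: "('u, 'p, 't) statement set \<Rightarrow> ('u, 'p, 't) rdf_term set" where
  "domR G = uni (strict_graph G) \<union> rho_df"

definition domP :: "('u, 'p, 't) statement set \<Rightarrow> ('u, 'p, 't) rdf_term set" where
  "domP G = rho_df \<union> {p \<in> uni (strict_graph G). \<exists>x y.
     (x, p, y) \<in> Cl (strict_graph G) \<or>
     (p, SP, x) \<in> Cl (strict_graph G) \<or> (x, SP, p) \<in> Cl (strict_graph G) \<or>
     (p, BOTP, x) \<in> Cl (strict_graph G) \<or> (x, BOTP, p) \<in> Cl (strict_graph G) \<or>
     (p, DOM, x) \<in> Cl (strict_graph G) \<or> (p, RNG, x) \<in> Cl (strict_graph G)}"

definition domC :: "('u, 'p, 't) statement set \<Rightarrow> ('u, 'p, 't) rdf_term set" where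
  "domC G = {c \<in> uni (strict_graph G). \<exists>x.
     (x, TYP, c) \<in> Cl (strict_graph G) \<or>
     (x, DOM, c) \<in> Cl (strict_graph G) \<or> (x, RNG, c) \<in> Cl (strict_graph G) \<or>
     (c, SC, x) \<in> Cl (strict_graph G) \<or> (x, SC, c) \<in> Cl (strict_graph G) \<or>
     (c, BOTC, x) \<in> Cl (strict_graph G) \<or> (x, BOTC, c) \<in> Cl (strict_graph G)}"

definition domL :: "('u, 'p, 't) statement set \<Rightarrow> ('u, 'p, 't) rdf_term set" where
  "domL G = uni (strict_graph G) \<inter> literals"

definition interps :: "('u, 'p, 't) statement set \<Rightarrow> ('u, 'p, 't) rdf_term interp set" where
  "interps G = {I. is_interp (rho_df \<union> uni (strict_graph G)) I \<and>
     dR I = domR G \<and> dP I = domP G \<and> dC I = domC G \<and> dL I = domL G}"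

text \<open>
  A ranked interpretation \<open>(\<M>, r)\<close> is represented by \<open>r\<close> alone, made extensional on
  \<open>\<M> = interps G\<close>, so that there is a unique minimal ranked model also as a function and \<open>THE\<close> is
  applicable in \<open>min_ranked_model\<close>.
\<close>

type_synonym ('u, 'p, 't) ranking = "('u, 'p, 't) rdf_term interp \<Rightarrow> enat"

definition is_ranked_interp ::
  "('u, 'p, 't) statement set \<Rightarrow> ('u, 'p, 't) ranking \<Rightarrow> bool" where
  "is_ranked_interp G r \<longleftrightarrow>
     r \<in> extensional (interps G) \<and>
     (\<exists>I \<in> interps G. r I = 0) \<and>
     (\<forall>i::nat. i > 0 \<longrightarrow> (\<exists>I \<in> interps G. r I = enat i) \<longrightarrow>
        (\<exists>I \<in> interps G. r I = enat (i - 1)))"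

definition fin_interps ::
  "('u, 'p, 't) statement set \<Rightarrow> ('u, 'p, 't) ranking \<Rightarrow> ('u, 'p, 't) rdf_term interp set" where
  "fin_interps G r = {I \<in> interps G. r I < \<infinity>}"

definition cmin ::
  "('u, 'p, 't) statement set \<Rightarrow> ('u, 'p, 't) rdf_term \<Rightarrow> ('u, 'p, 't) ranking \<Rightarrow>
   ('u, 'p, 't) rdf_term interp set" where
  "cmin G t r = {I \<in> fin_interps G r. \<not> satisfies I {(t, BOTC, t)} \<and>
     (\<forall>J \<in> fin_interps G r. \<not> satisfies J {(t, BOTC, t)} \<longrightarrow> r I \<le> r J)}"

definition pmin ::
  "('u, 'p, 't) statement set \<Rightarrow> ('u, 'p, 't) rdf_term \<Rightarrow> ('u, 'p, 't) ranking \<Rightarrow>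
   ('u, 'p, 't) rdf_term interp set" where
  "pmin G t r = {I \<in> fin_interps G r. \<not> satisfies I {(t, BOTP, t)} \<and>
     (\<forall>J \<in> fin_interps G r. \<not> satisfies J {(t, BOTP, t)} \<longrightarrow> r I \<le> r J)}"

fun ranked_satisfies ::
  "('u, 'p, 't) statement set \<Rightarrow> ('u, 'p, 't) ranking \<Rightarrow> ('u, 'p, 't) statement \<Rightarrow> bool" where
  "ranked_satisfies G r (Strict \<tau>) \<longleftrightarrow> (\<forall>I \<in> fin_interps G r. satisfies I {\<tau>})"
| "ranked_satisfies G r (Defeasible (s, p, o')) \<longleftrightarrow>
     (p = SC \<and> (\<forall>I \<in> cmin G s r. satisfies I {(s, SC, o')})) \<or>
     (p = SP \<and> (\<forall>I \<in> pmin G s r. satisfies I {(s, SP, o')}))"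

definition is_ranked_model ::
  "('u, 'p, 't) statement set \<Rightarrow> ('u, 'p, 't) ranking \<Rightarrow> bool" where
  "is_ranked_model G r \<longleftrightarrow> is_ranked_interp G r \<and> (\<forall>\<sigma>\<in>G. ranked_satisfies G r \<sigma>)"

definition ranking_le ::
  "('u, 'p, 't) statement set \<Rightarrow> ('u, 'p, 't) ranking \<Rightarrow> ('u, 'p, 't) ranking \<Rightarrow> bool" where
  "ranking_le G r r' \<longleftrightarrow> (\<forall>I \<in> interps G. r I \<le> r' I)"

definition is_minimal_ranked_model ::
  "('u, 'p, 't) statement set \<Rightarrow> ('u, 'p, 't) ranking \<Rightarrow> bool" where
  "is_minimal_ranked_model G r \<longleftrightarrow> is_ranked_model G r \<and>
     (\<forall>r'. is_ranked_model G r' \<and> ranking_le G r' r \<longrightarrow> ranking_le G r r')"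

definition min_ranked_model :: "('u, 'p, 't) statement set \<Rightarrow> ('u, 'p, 't) ranking" where
  "min_ranked_model G = (THE r. is_minimal_ranked_model G r)"

definition min_entails ::
  "('u, 'p, 't) statement set \<Rightarrow> ('u, 'p, 't) statement \<Rightarrow> bool" where
  "min_entails G \<tau> \<longleftrightarrow> ranked_satisfies G (min_ranked_model G) \<tau>"


section \<open>Procedures\<close>

primrec D_seq :: "('u, 'p, 't) statement set \<Rightarrow> nat \<Rightarrow> ('u, 'p, 't) statement set" where
  "D_seq G 0 = def_part G"
| "D_seq G (Suc i) =
     {Defeasible (p, SC, q) | p q. Defeasible (p, SC, q) \<in> D_seq G i \<and>
        derives (str_part G \<union> strictify (D_seq G i)) (p, BOTC, p)} \<union>
     {Defeasible (p, SP, q) | p q. Defeasible (p, SP, q) \<in> D_seq G i \<and>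
        derives (str_part G \<union> strictify (D_seq G i)) (p, BOTP, p)}"

text \<open>The output \<open>{D\<^sub>0, \<dots>, D\<^sub>n, D\<^sub>\<infinity>}\<close> of the ranking procedure, as a list of length \<open>n + 2\<close>.\<close>

definition Ranking :: "('u, 'p, 't) statement set \<Rightarrow> ('u, 'p, 't) statement set list" where
  "Ranking G =
     (let n = (LEAST n. D_seq G n = D_seq G (Suc n));
          D_inf = D_seq G n
      in map (D_seq G) [0..<Suc n] @ [D_inf])"

text \<open>
  The assignment \<open>D\<^sub>n\<^sub>+\<^sub>1 = D\<^sub>\<infinity>\<close> is implicit in the position \<open>n + 1\<close> of \<open>D\<^sub>\<infinity>\<close> in the list \<open>Ds\<close>.
\<close>

definition DefMinEntailmentP ::
  "('u, 'p, 't) statement set \<Rightarrow> ('u, 'p, 't) statement set list \<Rightarrow>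
   ('u, 'p, 't) rdf_term \<Rightarrow> ('u, 'p, 't) rdf_term \<Rightarrow> bool" where
  "DefMinEntailmentP G Ds p q =
     (let n = length Ds - 2;
          exceptional = (\<lambda>i. derives (str_part G \<union> strictify (Ds ! i)) (p, BOTP, p))
      in if \<forall>i \<le> n. exceptional i then True
         else let j = (LEAST j. j \<le> n \<and> \<not> exceptional j);
                  Dp = {Defeasible (a, SP, b) | a b. Defeasible (a, SP, b) \<in> Ds ! j - Ds ! Suc j}
              in derives (str_part G \<union> strictify Dp) (p, SP, q))"

end

theory Submission
  imports Defs
begin

text \<open>
  Let \<open>M\<^sub>i\<close> be the set of interpretations that satisfy the strict part and, for every
  \<open>\<langle>a, e, b\<rangle> \<in> D\<^sub>i\<close>, satisfy \<open>(a, e, b)\<close> or make \<open>a\<close> impossible (\<open>(a, \<bottom>, a)\<close> holds).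
  Derivations from \<open>G\<^sup>s\<^sup>t\<^sup>r \<union> D\<^sub>i\<^sup>s\<close> are sound for \<open>M\<^sub>i\<close> up to impossibility of the subject, since
  impossibility propagates down subclass and subproperty chains, and a canonical interpretation
  in \<open>M\<^sub>i\<close> gives completeness. Hence \<open>a\<close> is exceptional at level \<open>i\<close> iff all of \<open>M\<^sub>i\<close> makes
  it impossible, and ranking an interpretation by the least \<open>i\<close> with membership in \<open>M\<^sub>i\<close> yields
  the least ranked model. If \<open>p\<close> is first possible at level \<open>j\<close>, its minimal interpretations are
  the members of \<open>M\<^sub>j\<close> in which it is possible, and no chain starting at \<open>p\<close> uses a triple of
  \<open>D\<^sub>j\<^sub>+\<^sub>1\<close>, as the subject of such a triple is impossible at level \<open>j\<close>.
\<close>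

section \<open>Derivable triples\<close>

lemma derives_is_triple:
  assumes "derives H \<tau>" "\<forall>\<sigma>\<in>H. is_triple \<sigma>"
  shows "is_triple \<tau>"
  using assms by (induction rule: derives.induct) auto

lemma derives_mono:
  assumes "derives H \<tau>" "H \<subseteq> K"
  shows "derives K \<tau>"
  using assms by (induction rule: derives.induct) (auto intro: derives.intros)

lemma rdf_constants_in_uris [simp]:
  "SP \<in> uris" "SC \<in> uris" "TYP \<in> uris" "DOM \<in> uris" "RNG \<in> uris" "BOTC \<in> uris" "BOTP \<in> uris"
  by (auto simp: uris_def rho_df_def)

lemma uni_insert [simp]: "uni (insert (s, e, t) H) = {s, e, t} \<union> uni H"
  by (auto simp: uni_def)

lemma uni_empty [simp]: "uni {} = {}"
  by (simp add: uni_def)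

lemma uniI: "(s, e, t) \<in> H \<Longrightarrow> s \<in> uni H \<and> e \<in> uni H \<and> t \<in> uni H"
  by (force simp: uni_def)

lemma uni_mono: "H \<subseteq> K \<Longrightarrow> uni H \<subseteq> uni K"
  by (force simp: uni_def)

locale triple_set =
  fixes H :: "('u, 'p, 't) triple set"
  assumes triples: "\<forall>\<sigma>\<in>H. is_triple \<sigma>"
begin

lemma derives_not_reserved:
  assumes "derives H (s, e, t)"
  shows "s \<notin> rho_df" "t \<notin> rho_df" "e \<in> uris"
  using derives_is_triple[OF assms triples] by (auto simp: is_triple_def)

text \<open>Rules \<open>r5c\<close> and \<open>r6c\<close> introduce an arbitrary object, hence the
  exception for \<open>BOTC\<close> and \<open>BOTP\<close>. It does not block \<open>r2b\<close>,
  \<open>r4a\<close> and \<open>r4b\<close>: the predicate of their second premise is also the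
  subject of a derived triple, so it is not reserved and the induction hypothesis applies.\<close>

lemma derives_uni:
  assumes "derives H \<tau>"
  shows "fst (snd \<tau>) \<notin> {BOTC, BOTP} \<longrightarrow>
    fst \<tau> \<in> uni H \<and> snd (snd \<tau>) \<in> uni H \<and> (fst (snd \<tau>) \<in> uni H \<or> fst (snd \<tau>) \<in> rho_df)"
  using assms
proof (induction rule: derives.induct)
  case (base \<tau>)
  then show ?case by (cases \<tau>) (auto dest: uniI)
next
  case (step T \<tau>)
  from step(1) show ?case
  proof cases
    case (r2b D E X Y)
    then have "derives H (D, SP, E)" using step(3) by auto
    then have "D \<notin> rho_df" by (rule derives_not_reserved)
    then show ?thesis using r2b step(3) by (auto simp: rho_df_def)
  next
    case (r4a D B X Y)
    then have "derives H (D, DOM, B)" using step(3) by auto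
    then have "D \<notin> rho_df" by (rule derives_not_reserved)
    then show ?thesis using r4a step(3) by (auto simp: rho_df_def)
  next
    case (r4b D B X Y)
    then have "derives H (D, RNG, B)" using step(3) by auto
    then have "D \<notin> rho_df" by (rule derives_not_reserved)
    then show ?thesis using r4b step(3) by (auto simp: rho_df_def)
  qed (use step(3) in \<open>auto simp: rho_df_def\<close>)
qed

lemma derives_uni_triple:
  assumes "derives H (s, e, t)" "e \<notin> {BOTC, BOTP}"
  shows "s \<in> uni H" "t \<in> uni H"
  using derives_uni[OF assms(1)] assms(2) by auto

lemma rule_derives:
  assumes "rho_rule T (s, e, t)" "\<forall>\<sigma>\<in>T. derives H \<sigma>" "e \<in> uris" "s \<notin> rho_df" "t \<notin> rho_df"
  shows "derives H (s, e, t)"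
  using assms by (intro derives.step[of T]) (auto simp: is_triple_def)

lemma sp_trans: "derives H (a, SP, b) \<Longrightarrow> derives H (b, SP, c) \<Longrightarrow> derives H (a, SP, c)"
  by (rule rule_derives[OF r2a]) (auto dest: derives_not_reserved)

lemma sc_trans: "derives H (a, SC, b) \<Longrightarrow> derives H (b, SC, c) \<Longrightarrow> derives H (a, SC, c)"
  by (rule rule_derives[OF r3a]) (auto dest: derives_not_reserved)

lemma botc_sym: "derives H (a, BOTC, b) \<Longrightarrow> derives H (b, BOTC, a)"
  by (rule rule_derives[OF r5a]) (auto dest: derives_not_reserved)

lemma botp_sym: "derives H (a, BOTP, b) \<Longrightarrow> derives H (b, BOTP, a)"
  by (rule rule_derives[OF r6a]) (auto dest: derives_not_reserved)

lemma botc_down: "derives H (a, BOTC, b) \<Longrightarrow> derives H (c, SC, a) \<Longrightarrow> derives H (c, BOTC, b)"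
  by (rule rule_derives[OF r5b]) (auto dest: derives_not_reserved)

lemma botp_down: "derives H (a, BOTP, b) \<Longrightarrow> derives H (c, SP, a) \<Longrightarrow> derives H (c, BOTP, b)"
  by (rule rule_derives[OF r6b]) (auto dest: derives_not_reserved)

lemma botc_all: "derives H (a, BOTC, a) \<Longrightarrow> b \<notin> rho_df \<Longrightarrow> derives H (a, BOTC, b)"
  by (rule rule_derives[OF r5c]) (auto dest: derives_not_reserved)

lemma botp_dom:
  "derives H (a, DOM, c) \<Longrightarrow> derives H (b, DOM, d) \<Longrightarrow> derives H (c, BOTC, d) \<Longrightarrow> derives H (a, BOTP, b)"
  by (rule rule_derives[OF r7a]) (auto dest: derives_not_reserved)

lemma botp_rng:
  "derives H (a, RNG, c) \<Longrightarrow> derives H (b, RNG, d) \<Longrightarrow> derives H (c, BOTC, d) \<Longrightarrow> derives H (a, BOTP, b)"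
  by (rule rule_derives[OF r7b]) (auto dest: derives_not_reserved)

text \<open>\<open>botp_down\<close> replaces only the first argument; symmetry between two uses of
  it replaces the second one as well. So impossibility of a property passes to its
  subproperties.\<close>

lemma botp_self_down:
  assumes "derives H (b, BOTP, b)" "derives H (a, SP, b)"
  shows "derives H (a, BOTP, a)"
  using botp_down[OF botp_sym[OF botp_down[OF assms]] assms(2)] .

end


section \<open>Satisfaction\<close>

text \<open>The structural clauses of \<open>satisfies\<close> do not mention the triples of the
  graph; \<open>satisfies I {}\<close> collects them, and a single triple adds only conditions on
  its own terms.\<close>

lemma satisfies_singleton:
  "satisfies I {(s, e, t)} \<longleftrightarrow> satisfies I {} \<and> {s, e, t} \<subseteq> voc I \<and> den I e \<in> dP I \<and>
     (den I s, den I t) \<in> Pd I e"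
  unfolding satisfies_def by auto

lemma satisfies_empty:
  assumes "satisfies I {}"
  shows "rho_df \<subseteq> voc I" "\<And>e. e \<in> rho_df \<Longrightarrow> den I e \<in> dP I"
    "trans_on (dP I) (Pd I SP)"
    "\<And>p q. (p, q) \<in> Pd I SP \<Longrightarrow> p \<in> dP I \<and> q \<in> dP I"
    "trans_on (dC I) (Pd I SC)"
    "\<And>p q. (p, q) \<in> Pd I SC \<Longrightarrow> p \<in> dC I \<and> q \<in> dC I"
    "\<And>p c. (p, c) \<in> Pd I DOM \<Longrightarrow> p \<in> dP I \<and> c \<in> dC I"
    "\<And>p c. (p, c) \<in> Pd I RNG \<Longrightarrow> p \<in> dP I \<and> c \<in> dC I"
    "Pd I BOTC \<subseteq> dC I \<times> dC I" "\<And>c d. (c, d) \<in> Pd I BOTC \<Longrightarrow> (d, c) \<in> Pd I BOTC"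
    "\<And>c d e. (c, d) \<in> Pd I BOTC \<Longrightarrow> (e, c) \<in> Pd I SC \<Longrightarrow> (e, d) \<in> Pd I BOTC"
    "\<And>c d. (c, c) \<in> Pd I BOTC \<Longrightarrow> d \<in> dC I \<Longrightarrow> (c, d) \<in> Pd I BOTC"
    "Pd I BOTP \<subseteq> dP I \<times> dP I" "\<And>c d. (c, d) \<in> Pd I BOTP \<Longrightarrow> (d, c) \<in> Pd I BOTP"
    "\<And>c d e. (c, d) \<in> Pd I BOTP \<Longrightarrow> (e, c) \<in> Pd I SP \<Longrightarrow> (e, d) \<in> Pd I BOTP"
    "\<And>c d. (c, c) \<in> Pd I BOTP \<Longrightarrow> d \<in> dP I \<Longrightarrow> (c, d) \<in> Pd I BOTP"
    "\<And>p q c d. (p, c) \<in> Pd I DOM \<Longrightarrow> (q, d) \<in> Pd I DOM \<Longrightarrow> (c, d) \<in> Pd I BOTC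
       \<Longrightarrow> (p, q) \<in> Pd I BOTP"
    "\<And>p q c d. (p, c) \<in> Pd I RNG \<Longrightarrow> (q, d) \<in> Pd I RNG \<Longrightarrow> (c, d) \<in> Pd I BOTC
       \<Longrightarrow> (p, q) \<in> Pd I BOTP"
proof -
  have "rho_df \<union> uni {} \<subseteq> voc I"
    using assms unfolding satisfies_def by (elim conjE)
  then show "rho_df \<subseteq> voc I" by simp
  have facts:
    "\<forall>e \<in> rho_df. den I e \<in> dP I"
    "\<forall>(p, q) \<in> Pd I SP. p \<in> dP I \<and> q \<in> dP I \<and> pext I p \<subseteq> pext I q"
    "\<forall>(c, d) \<in> Pd I SC. c \<in> dC I \<and> d \<in> dC I \<and> cext I c \<subseteq> cext I d"
    "\<forall>(p, c) \<in> Pd I DOM. p \<in> dP I \<and> c \<in> dC I \<and> (\<forall>(x, y) \<in> pext I p. x \<in> cext I c)"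
    "\<forall>(p, c) \<in> Pd I RNG. p \<in> dP I \<and> c \<in> dC I \<and> (\<forall>(x, y) \<in> pext I p. y \<in> cext I c)"
    "sym (Pd I BOTC)"
    "\<forall>c d e. (c, d) \<in> Pd I BOTC \<and> (e, c) \<in> Pd I SC \<longrightarrow> (e, d) \<in> Pd I BOTC"
    "\<forall>c. \<forall>d \<in> dC I. (c, c) \<in> Pd I BOTC \<longrightarrow> (c, d) \<in> Pd I BOTC"
    "sym (Pd I BOTP)"
    "\<forall>p q e. (p, q) \<in> Pd I BOTP \<and> (e, p) \<in> Pd I SP \<longrightarrow> (e, q) \<in> Pd I BOTP"
    "\<forall>p. \<forall>q \<in> dP I. (p, p) \<in> Pd I BOTP \<longrightarrow> (p, q) \<in> Pd I BOTP"
    "\<forall>p q c d. (p, c) \<in> Pd I DOM \<and> (q, d) \<in> Pd I DOM \<and> (c, d) \<in> Pd I BOTC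
       \<longrightarrow> (p, q) \<in> Pd I BOTP"
    "\<forall>p q c d. (p, c) \<in> Pd I RNG \<and> (q, d) \<in> Pd I RNG \<and> (c, d) \<in> Pd I BOTC
       \<longrightarrow> (p, q) \<in> Pd I BOTP"
    using assms unfolding satisfies_def by - (elim conjE, assumption)+
  show "trans_on (dP I) (Pd I SP)" "trans_on (dC I) (Pd I SC)"
    "Pd I BOTC \<subseteq> dC I \<times> dC I" "Pd I BOTP \<subseteq> dP I \<times> dP I"
    using assms unfolding satisfies_def by - (elim conjE, assumption)+
  show "\<And>e. e \<in> rho_df \<Longrightarrow> den I e \<in> dP I" using facts(1) by blast
  show "\<And>p q. (p, q) \<in> Pd I SP \<Longrightarrow> p \<in> dP I \<and> q \<in> dP I" using facts(2) by blast
  show "\<And>p q. (p, q) \<in> Pd I SC \<Longrightarrow> p \<in> dC I \<and> q \<in> dC I" using facts(3) by blast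
  show "\<And>p c. (p, c) \<in> Pd I DOM \<Longrightarrow> p \<in> dP I \<and> c \<in> dC I" using facts(4) by blast
  show "\<And>p c. (p, c) \<in> Pd I RNG \<Longrightarrow> p \<in> dP I \<and> c \<in> dC I" using facts(5) by blast
  show "\<And>c d. (c, d) \<in> Pd I BOTC \<Longrightarrow> (d, c) \<in> Pd I BOTC" using facts(6) by (rule symD)
  show "\<And>c d. (c, d) \<in> Pd I BOTP \<Longrightarrow> (d, c) \<in> Pd I BOTP" using facts(9) by (rule symD)
  show "\<And>c d e. (c, d) \<in> Pd I BOTC \<Longrightarrow> (e, c) \<in> Pd I SC \<Longrightarrow> (e, d) \<in> Pd I BOTC"
    using facts(7) by blast
  show "\<And>c d e. (c, d) \<in> Pd I BOTP \<Longrightarrow> (e, c) \<in> Pd I SP \<Longrightarrow> (e, d) \<in> Pd I BOTP"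
    using facts(10) by blast
  show "\<And>c d. (c, c) \<in> Pd I BOTC \<Longrightarrow> d \<in> dC I \<Longrightarrow> (c, d) \<in> Pd I BOTC"
    using facts(8) by blast
  show "\<And>c d. (c, c) \<in> Pd I BOTP \<Longrightarrow> d \<in> dP I \<Longrightarrow> (c, d) \<in> Pd I BOTP"
    using facts(11) by blast
  show "\<And>p q c d. (p, c) \<in> Pd I DOM \<Longrightarrow> (q, d) \<in> Pd I DOM \<Longrightarrow> (c, d) \<in> Pd I BOTC
       \<Longrightarrow> (p, q) \<in> Pd I BOTP" using facts(12) by blast
  show "\<And>p q c d. (p, c) \<in> Pd I RNG \<Longrightarrow> (q, d) \<in> Pd I RNG \<Longrightarrow> (c, d) \<in> Pd I BOTC
       \<Longrightarrow> (p, q) \<in> Pd I BOTP" using facts(13) by blast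
qed

section \<open>Soundness of derivation up to impossible subjects\<close>

text \<open>Lets the class case and the property case share their statements: for a link with
  predicate \<open>e\<close>, the triple \<open>(a, bot_of e, a)\<close> expresses that its subject
  \<open>a\<close> is impossible.\<close>

definition bot_of :: "('u, 'p, 't) rdf_term \<Rightarrow> ('u, 'p, 't) rdf_term" where
  "bot_of e = (if e = SC then BOTC else BOTP)"

lemma bot_of_simps [simp]: "bot_of SC = BOTC" "bot_of SP = BOTP"
  by (simp_all add: bot_of_def)

text \<open>
  A subproperty or subclass link is only respected up to impossibility of its subject: that is
  all that a ranked model guarantees for a defeasible triple.
\<close>

definition weakly_satisfies ::
  "('u, 'p, 't) rdf_term interp \<Rightarrow> ('u, 'p, 't) triple \<Rightarrow> bool" where
  "weakly_satisfies I = (\<lambda>(s, e, t). satisfies I {(s, e, t)} \<or>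
     e \<in> {SC, SP} \<and> satisfies I {(s, bot_of e, s)})"

text \<open>
  Rules \<open>5c\<close> and \<open>6c\<close> derive disjointness from terms that need not denote a class or property,
  so disjointness is only required of those that do.
\<close>

fun sound_in :: "('u, 'p, 't) rdf_term interp \<Rightarrow> ('u, 'p, 't) triple \<Rightarrow> bool" where
  "sound_in I (s, e, t) \<longleftrightarrow>
     (e \<in> {SP, SC, DOM, RNG} \<longrightarrow> {s, t} \<subseteq> voc I \<and> weakly_satisfies I (s, e, t)) \<and>
     (e = BOTC \<longrightarrow> (s = t \<longrightarrow> s \<in> voc I \<and> den I s \<in> dC I) \<and>
        ({s, t} \<subseteq> voc I \<and> den I s \<in> dC I \<and> den I t \<in> dC I \<longrightarrow> (den I s, den I t) \<in> Pd I BOTC)) \<and>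
     (e = BOTP \<longrightarrow> (s = t \<longrightarrow> s \<in> voc I \<and> den I s \<in> dP I) \<and>
        ({s, t} \<subseteq> voc I \<and> den I s \<in> dP I \<and> den I t \<in> dP I \<longrightarrow> (den I s, den I t) \<in> Pd I BOTP))"

context triple_set
begin

text \<open>The transitivity rules survive weak satisfaction because impossibility of the middle
  term passes down to the subject. The disjointness rules survive because an impossible class is
  disjoint from every class, and likewise for properties.\<close>

lemma derives_sound:
  assumes "derives H \<tau>"
    and weak: "\<And>\<sigma>. \<sigma> \<in> H \<Longrightarrow> weakly_satisfies I \<sigma>"
    and st: "satisfies I {}"
    and voc: "uni H \<subseteq> voc I"
  shows "sound_in I \<tau>"
  using assms(1)
proof (induction rule: derives.induct)
  case (base \<tau>)
  obtain s e t where \<tau>: "\<tau> = (s, e, t)" by (cases \<tau>)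
  have "{s, t} \<subseteq> voc I" using base \<tau> uniI voc by fastforce
  then show ?case
    using weak[OF base] \<tau> satisfies_empty(9,13)[OF st]
    by (auto simp: weakly_satisfies_def satisfies_singleton)
next
  case (step T \<tau>)
  note sat = satisfies_empty[OF st]
  have rd: "SP \<in> voc I" "SC \<in> voc I" "BOTC \<in> voc I" "BOTP \<in> voc I"
     "den I SP \<in> dP I" "den I SC \<in> dP I" "den I BOTC \<in> dP I" "den I BOTP \<in> dP I"
    using sat(1,2) by (auto simp: rho_df_def)
  have wsp: "weakly_satisfies I (a, SP, b) \<longleftrightarrow> a \<in> voc I \<and>
      (b \<in> voc I \<and> (den I a, den I b) \<in> Pd I SP \<or> (den I a, den I a) \<in> Pd I BOTP)" for a b
    by (auto simp: weakly_satisfies_def satisfies_singleton rd st)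
  have wsc: "weakly_satisfies I (a, SC, b) \<longleftrightarrow> a \<in> voc I \<and>
      (b \<in> voc I \<and> (den I a, den I b) \<in> Pd I SC \<or> (den I a, den I a) \<in> Pd I BOTC)" for a b
    by (auto simp: weakly_satisfies_def satisfies_singleton rd st)
  from step(1) show ?case
  proof cases
    case (r2a A B C)
    have "sound_in I (A, SP, B)" "sound_in I (B, SP, C)" using step(3) r2a by auto
    then have 1: "weakly_satisfies I (A, SP, B)" "weakly_satisfies I (B, SP, C)" "C \<in> voc I"
      by auto
    \<comment> \<open>A genuine link from \<open>A\<close> to an impossible \<open>B\<close> makes
      \<open>A\<close> impossible, by two uses of \<open>sat(15)\<close> with symmetry in between.
      Otherwise \<open>A\<close> is already impossible or both links are genuine and
      compose.\<close>
    have "(den I A, den I A) \<in> Pd I BOTP \<or> (den I A, den I C) \<in> Pd I SP"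
    proof (cases "(den I A, den I B) \<in> Pd I SP \<and> (den I B, den I B) \<in> Pd I BOTP")
      case True
      then have "(den I B, den I A) \<in> Pd I BOTP" using sat(14)[OF sat(15)] by blast
      then show ?thesis using True sat(15) by blast
    next
      case False
      then show ?thesis using 1 sat(4) trans_onD[OF sat(3)] unfolding wsp by blast
    qed
    then show ?thesis using r2a 1 by (auto simp: wsp)
  next
    case (r3a A B C)
    have "sound_in I (A, SC, B)" "sound_in I (B, SC, C)" using step(3) r3a by auto
    then have 1: "weakly_satisfies I (A, SC, B)" "weakly_satisfies I (B, SC, C)" "C \<in> voc I"
      by auto
    have "(den I A, den I A) \<in> Pd I BOTC \<or> (den I A, den I C) \<in> Pd I SC"
    proof (cases "(den I A, den I B) \<in> Pd I SC \<and> (den I B, den I B) \<in> Pd I BOTC")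
      case True
      then have "(den I B, den I A) \<in> Pd I BOTC" using sat(10)[OF sat(11)] by blast
      then show ?thesis using True sat(11) by blast
    next
      case False
      then show ?thesis using 1 sat(6) trans_onD[OF sat(5)] unfolding wsc by blast
    qed
    then show ?thesis using r3a 1 by (auto simp: wsc)
  next
    case (r2b D E X Y)
    \<comment> \<open>Rule \<open>r2b\<close> only concludes triples with a non-reserved predicate,
      of which \<open>sound_in\<close> demands nothing.\<close>
    then have "derives H (D, SP, E)" using step(3) by auto
    then have "E \<notin> rho_df" by (rule derives_not_reserved)
    then show ?thesis using r2b by (auto simp: rho_df_def)
  next
    case (r5b A B C)
    have 1: "sound_in I (A, BOTC, B)" "sound_in I (C, SC, A)" using step(3) r5b by auto
    then have link: "C \<in> voc I" "A \<in> voc I"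
        "(den I C, den I A) \<in> Pd I SC \<or> (den I C, den I C) \<in> Pd I BOTC"
      by (auto simp: wsc)
    then have C: "den I C \<in> dC I" using sat(6,9) by blast
    \<comment> \<open>Disjointness passes down along a genuine link; without one, \<open>C\<close>
      is impossible and hence disjoint from every class.\<close>
    have "(den I C, den I B) \<in> Pd I BOTC" if "B \<in> voc I" "den I B \<in> dC I"
      using link(3)
    proof
      assume CA: "(den I C, den I A) \<in> Pd I SC"
      then have "(den I A, den I B) \<in> Pd I BOTC" using 1 link(2) sat(6) that by simp
      then show ?thesis using CA by (rule sat(11))
    qed (use sat(12) that in blast)
    then show ?thesis using r5b link(1) C by auto
  next
    case (r6b A B C)
    have 1: "sound_in I (A, BOTP, B)" "sound_in I (C, SP, A)" using step(3) r6b by auto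
    then have link: "C \<in> voc I" "A \<in> voc I"
        "(den I C, den I A) \<in> Pd I SP \<or> (den I C, den I C) \<in> Pd I BOTP"
      by (auto simp: wsp)
    then have C: "den I C \<in> dP I" using sat(4,13) by blast
    have "(den I C, den I B) \<in> Pd I BOTP" if "B \<in> voc I" "den I B \<in> dP I"
      using link(3)
    proof
      assume CA: "(den I C, den I A) \<in> Pd I SP"
      then have "(den I A, den I B) \<in> Pd I BOTP" using 1 link(2) sat(4) that by simp
      then show ?thesis using CA by (rule sat(15))
    qed (use sat(16) that in blast)
    then show ?thesis using r6b link(1) C by auto
  next
    case (r7a A C B D)
    have "sound_in I (A, DOM, C)" "sound_in I (B, DOM, D)" "sound_in I (C, BOTC, D)"
      using step(3) r7a by auto
    then have AB: "A \<in> voc I" "C \<in> voc I" "D \<in> voc I" "(den I A, den I C) \<in> Pd I DOM"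
        "(den I B, den I D) \<in> Pd I DOM"
      and CD: "{C, D} \<subseteq> voc I \<and> den I C \<in> dC I \<and> den I D \<in> dC I
        \<longrightarrow> (den I C, den I D) \<in> Pd I BOTC"
      by (simp_all add: weakly_satisfies_def satisfies_singleton)
    then have "(den I A, den I B) \<in> Pd I BOTP"
      using sat(7)[OF AB(4)] sat(7)[OF AB(5)] sat(17)[OF AB(4,5)] by simp
    then show ?thesis using r7a AB(1) sat(13) by auto
  next
    case (r7b A C B D)
    have "sound_in I (A, RNG, C)" "sound_in I (B, RNG, D)" "sound_in I (C, BOTC, D)"
      using step(3) r7b by auto
    then have AB: "A \<in> voc I" "C \<in> voc I" "D \<in> voc I" "(den I A, den I C) \<in> Pd I RNG"
        "(den I B, den I D) \<in> Pd I RNG"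
      and CD: "{C, D} \<subseteq> voc I \<and> den I C \<in> dC I \<and> den I D \<in> dC I
        \<longrightarrow> (den I C, den I D) \<in> Pd I BOTC"
      by (simp_all add: weakly_satisfies_def satisfies_singleton)
    then have "(den I A, den I B) \<in> Pd I BOTP"
      using sat(8)[OF AB(4)] sat(8)[OF AB(5)] sat(18)[OF AB(4,5)] by simp
    then show ?thesis using r7b AB(1) sat(13) by auto
  next
    case (r5a A B)
    then have "sound_in I (A, BOTC, B)" using step(3) by auto
    then show ?thesis using r5a sat(10)[of "den I A" "den I B"] by auto
  next
    case (r6a A B)
    then have "sound_in I (A, BOTP, B)" using step(3) by auto
    then show ?thesis using r6a sat(14)[of "den I A" "den I B"] by auto
  next
    case (r5c A B)
    then have "sound_in I (A, BOTC, A)" using step(3) by auto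
    then show ?thesis using r5c sat(12)[of "den I A" "den I B"] by auto
  next
    case (r6c A B)
    then have "sound_in I (A, BOTP, A)" using step(3) by auto
    then show ?thesis using r6c sat(16)[of "den I A" "den I B"] by auto
  qed auto
qed

end


section \<open>The canonical interpretation\<close>

text \<open>
  Nothing about \<open>type\<close> or the non-reserved predicates feeds back into the derivation of
  subproperty, subclass and disjointness triples, so these are interpreted by the full relations.
\<close>

definition canon ::
  "('u, 'p, 't) statement set \<Rightarrow> ('u, 'p, 't) triple set \<Rightarrow> ('u, 'p, 't) rdf_term interp" where
  "canon G H = \<lparr>voc = rho_df \<union> uni (strict_graph G),
     dR = domR G, dP = domP G, dC = domC G, dL = domL G,
     pext = (\<lambda>e \<in> domP G.
       if e \<in> {SP, SC, DOM, RNG} then {(a, b). derives H (a, e, b)}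
       else if e = BOTC then {(a, b) \<in> domC G \<times> domC G. derives H (a, BOTC, b)}
       else if e = BOTP then {(a, b) \<in> domP G \<times> domP G.
         derives H (a, BOTP, b) \<or> derives H (a, BOTP, a) \<or> derives H (b, BOTP, b)}
       else if e = TYP then domR G \<times> domC G
       else domR G \<times> domR G),
     cext = (\<lambda>c \<in> domC G. domR G),
     den = (\<lambda>x \<in> rho_df \<union> uni (strict_graph G). x)\<rparr>"

text \<open>All interpretations of a ranked model share the domains computed from
  \<open>strict_graph G\<close>, whereas \<open>canon G H\<close> takes derivability from the
  possibly smaller \<open>H\<close>. The locale keeps the two graphs apart, and its instances are
  the levels of the ranking.\<close>

locale subgraph = triple_set H for H :: "('u, 'p, 't) triple set" +
  fixes G :: "('u, 'p, 't) statement set"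
  assumes sub: "H \<subseteq> strict_graph G"
    and graph: "is_graph (strict_graph G)"
begin

lemma derives_Cl: "derives H \<tau> \<Longrightarrow> \<tau> \<in> Cl (strict_graph G)"
  using derives_mono[OF _ sub] by (auto simp: Cl_def)

lemma uni_sub: "uni H \<subseteq> uni (strict_graph G)"
  by (rule uni_mono[OF sub])

lemma finite_uni: "finite (uni (strict_graph G))"
  using graph by (auto simp: uni_def is_graph_def)

lemma dom_subsets: "domC G \<subseteq> domR G" "domP G \<subseteq> domR G" "rho_df \<subseteq> domP G" "rho_df \<subseteq> domR G"
  "uni (strict_graph G) \<subseteq> domR G"
  by (auto simp: domR_def domC_def domP_def)

lemma domC_not_reserved: "c \<in> domC G \<Longrightarrow> c \<notin> rho_df"
  using triple_set.derives_not_reserved(1,2)[of "strict_graph G"] graph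
  unfolding domC_def Cl_def triple_set_def is_graph_def by blast

lemma sp_domP:
  assumes "derives H (a, SP, b)"
  shows "a \<in> domP G" "b \<in> domP G"
  using derives_Cl[OF assms] derives_uni_triple[OF assms] uni_sub by (auto simp: domP_def)

lemma sc_domC:
  assumes "derives H (a, SC, b)"
  shows "a \<in> domC G" "b \<in> domC G"
  using derives_Cl[OF assms] derives_uni_triple[OF assms] uni_sub by (auto simp: domC_def)

lemma dom_dom:
  assumes "derives H (a, DOM, b)"
  shows "a \<in> domP G" "b \<in> domC G"
  using derives_Cl[OF assms] derives_uni_triple[OF assms] uni_sub by (auto simp: domP_def domC_def)

lemma rng_dom:
  assumes "derives H (a, RNG, b)"
  shows "a \<in> domP G" "b \<in> domC G"
  using derives_Cl[OF assms] derives_uni_triple[OF assms] uni_sub by (auto simp: domP_def domC_def)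

lemma canon_interp: "canon G H \<in> interps G"
proof -
  have "is_interp (rho_df \<union> uni (strict_graph G)) (canon G H)"
    unfolding is_interp_def
  proof (intro conjI)
    have "{(a, b). derives H (a, e, b)} \<subseteq> domR G \<times> domR G" if "e \<in> {SP, SC, DOM, RNG}" for e
      using that derives_uni_triple uni_sub dom_subsets(5) by blast
    then show "pext (canon G H) \<in> dP (canon G H) \<rightarrow>\<^sub>E Pow (dR (canon G H) \<times> dR (canon G H))"
      using dom_subsets(1,2) by (auto simp: canon_def PiE_iff split: if_splits)
    show "finite (dR (canon G H))" "finite (dP (canon G H))" "finite (dC (canon G H))"
         "finite (dL (canon G H))"
      using finite_uni
      by (auto simp: canon_def domR_def domP_def domC_def domL_def rho_df_def)
  qed (auto simp: canon_def domR_def domC_def domL_def domP_def literals_def plain_literals_def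
        rho_df_def)
  then show ?thesis by (auto simp: interps_def canon_def)
qed

lemma canon_den: "x \<in> rho_df \<union> uni (strict_graph G) \<Longrightarrow> den (canon G H) x = x"
  by (auto simp: canon_def)

lemma canon_Pd:
  "e \<in> {SP, SC, DOM, RNG} \<Longrightarrow> Pd (canon G H) e = {(a, b). derives H (a, e, b)}"
  "Pd (canon G H) BOTC = {(a, b) \<in> domC G \<times> domC G. derives H (a, BOTC, b)}"
  "Pd (canon G H) BOTP = {(a, b) \<in> domP G \<times> domP G.
      derives H (a, BOTP, b) \<or> derives H (a, BOTP, a) \<or> derives H (b, BOTP, b)}"
  "Pd (canon G H) TYP = domR G \<times> domC G"
  "e \<in> domP G \<Longrightarrow> e \<notin> rho_df \<Longrightarrow> pext (canon G H) e = domR G \<times> domR G"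
  using dom_subsets(3) by (auto simp: canon_def Pd_def rho_df_def)

text \<open>The full relations settle the clauses on inclusions of extensions. As
  \<open>domP G\<close> contains the reserved constants but \<open>r6c\<close> derives no triple
  with a reserved object, derivability alone would not relate an impossible property to all of
  \<open>domP G\<close>; the two extra disjuncts for \<open>BOTP\<close> in \<open>canon\<close> do
  so, symmetrically. For \<open>BOTC\<close>, \<open>r5c\<close> suffices by
  \<open>domC_not_reserved\<close>.\<close>

lemma canon_structural: "satisfies (canon G H) {}"
proof -
  have [simp]: "voc (canon G H) = rho_df \<union> uni (strict_graph G)" "dP (canon G H) = domP G"
    "dC (canon G H) = domC G"
    by (simp_all add: canon_def)
  \<comment> \<open>Subproperty links relate non-reserved terms only, and in \<open>domP G\<close>
    these all have the full extension.\<close>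
  have sp_full: "pext (canon G H) p = domR G \<times> domR G \<and> pext (canon G H) q = domR G \<times> domR G"
    if "derives H (p, SP, q)" for p q
    using that canon_Pd(5) sp_domP derives_not_reserved by blast
  have cext: "cext (canon G H) c = domR G" if "c \<in> domC G" for c
    using that by (simp add: canon_def)
  show ?thesis
    unfolding satisfies_def
    apply (intro conjI)
                         apply (simp_all add: canon_Pd canon_den)
    subgoal using dom_subsets by (auto simp: canon_den)
    subgoal by (auto intro!: trans_onI intro: sp_trans)
    subgoal using sp_domP sp_full by blast
    subgoal by (auto intro!: trans_onI intro: sc_trans)
    subgoal using sc_domC cext by auto
    subgoal using cext by auto
    subgoal using dom_dom cext canon_Pd(5) derives_not_reserved by fastforce
    subgoal using rng_dom cext canon_Pd(5) derives_not_reserved by fastforce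
    subgoal by auto
    subgoal by (auto intro!: symI botc_sym)
    subgoal using sc_domC botc_down by blast
    subgoal using botc_all domC_not_reserved by blast
    subgoal by auto
    subgoal by (auto intro!: symI intro: botp_sym)
    \<comment> \<open>If the upper property is impossible, \<open>botp_self_down\<close> makes its
      subproperty impossible; if the other argument of the disjointness is impossible, that disjunct
      carries over unchanged.\<close>
    subgoal using sp_domP botp_down botp_self_down by blast
    subgoal using dom_dom botp_dom by blast
    subgoal using rng_dom botp_rng by blast
    done
qed

lemma canon_satisfies:
  assumes "\<tau> \<in> H"
  shows "satisfies (canon G H) {\<tau>}"
proof -
  obtain s e t where \<tau>: "\<tau> = (s, e, t)" by (cases \<tau>)
  have d: "derives H (s, e, t)" using assms \<tau> by (auto intro: derives.base)
  note cl = derives_Cl[OF d]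
  have u: "s \<in> uni (strict_graph G)" "e \<in> uni (strict_graph G)" "t \<in> uni (strict_graph G)"
    using uniI[of s e t] assms \<tau> sub by auto
  have e: "e \<in> domP G" using u cl by (auto simp: domP_def)
  have "(s, t) \<in> Pd (canon G H) e"
  proof -
    consider "e \<in> {SP, SC, DOM, RNG}" | "e = BOTC" | "e = BOTP" | "e = TYP" | "e \<notin> rho_df"
      by (auto simp: rho_df_def)
    then show ?thesis
    proof cases
      case 1
      then show ?thesis using d by (simp add: canon_Pd)
    next
      case 2
      then show ?thesis using d cl u by (auto simp: canon_Pd domC_def)
    next
      case 3
      then show ?thesis using d cl u by (auto simp: canon_Pd domP_def)
    next
      case 4
      then show ?thesis using d cl u by (auto simp: canon_Pd domC_def domR_def)
    next
      case 5
      then show ?thesis using e u dom_subsets by (auto simp: Pd_def canon_Pd canon_den)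
    qed
  qed
  then show ?thesis
    using u e by (simp add: \<tau> satisfies_singleton canon_structural canon_den) (simp add: canon_def)
qed

text \<open>Disjointness is treated on the diagonal, where the three disjuncts for
  \<open>BOTP\<close> in \<open>canon\<close> coincide with derivability; off the diagonal that
  relation may be larger.\<close>

lemma canon_complete:
  assumes "satisfies (canon G H) {(s, e, t)}"
  shows "e \<in> {SP, SC} \<Longrightarrow> derives H (s, e, t)"
    and "e \<in> {BOTC, BOTP} \<Longrightarrow> s = t \<Longrightarrow> derives H (s, e, t)"
proof -
  have "s \<in> rho_df \<union> uni (strict_graph G)" "t \<in> rho_df \<union> uni (strict_graph G)"
    "(den (canon G H) s, den (canon G H) t) \<in> Pd (canon G H) e"
    using assms by (auto simp: satisfies_singleton) (auto simp: canon_def)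
  then have "(s, t) \<in> Pd (canon G H) e" by (simp add: canon_den)
  then show "e \<in> {SP, SC} \<Longrightarrow> derives H (s, e, t)"
    and "e \<in> {BOTC, BOTP} \<Longrightarrow> s = t \<Longrightarrow> derives H (s, e, t)"
    by (auto simp: canon_Pd)
qed

end


section \<open>The least ranked model\<close>

text \<open>Membership in \<open>models_at\<close> yields the structural clauses only through some
  satisfied triple. Derivability from a level supplies such a triple, since every rule has a
  premise.\<close>

lemma derives_nonempty: "derives H \<tau> \<Longrightarrow> H \<noteq> {}"
proof (induction rule: derives.induct)
  case (step T \<tau>)
  from step(1) show ?case by cases (use step(3) in auto)
qed auto

definition level :: "('u, 'p, 't) statement set \<Rightarrow> nat \<Rightarrow> ('u, 'p, 't) triple set" where
  "level G i = str_part G \<union> strictify (D_seq G i)"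

definition models_at ::
  "('u, 'p, 't) statement set \<Rightarrow> nat \<Rightarrow> ('u, 'p, 't) rdf_term interp set" where
  "models_at G i = {I \<in> interps G. (\<forall>\<tau> \<in> str_part G. satisfies I {\<tau>}) \<and>
     (\<forall>\<tau>. Defeasible \<tau> \<in> D_seq G i \<longrightarrow> weakly_satisfies I \<tau>)}"

definition least_rank :: "('u, 'p, 't) statement set \<Rightarrow> ('u, 'p, 't) ranking" where
  "least_rank G = (\<lambda>I \<in> interps G.
     if \<exists>i. I \<in> models_at G i then enat (LEAST i. I \<in> models_at G i) else \<infinity>)"

text \<open>The common form of \<open>cmin\<close> and \<open>pmin\<close>, so that one argument
  covers both kinds of defeasible triple.\<close>

definition bot_min ::
  "('u, 'p, 't) statement set \<Rightarrow> ('u, 'p, 't) rdf_term \<Rightarrow> ('u, 'p, 't) rdf_term \<Rightarrow>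
   ('u, 'p, 't) ranking \<Rightarrow> ('u, 'p, 't) rdf_term interp set" where
  "bot_min G b t r = {I \<in> fin_interps G r. \<not> satisfies I {(t, b, t)} \<and>
     (\<forall>J \<in> fin_interps G r. \<not> satisfies J {(t, b, t)} \<longrightarrow> r I \<le> r J)}"

lemma ranked_satisfies_bot_min:
  assumes "e \<in> {SC, SP}"
  shows "ranked_satisfies G r (Defeasible (s, e, t)) \<longleftrightarrow>
    (\<forall>I \<in> bot_min G (bot_of e) s r. satisfies I {(s, e, t)})"
  using assms by (auto simp: cmin_def pmin_def bot_min_def)

lemma models_at_interps: "models_at G i \<subseteq> interps G"
  by (auto simp: models_at_def)

lemma least_rank_le: "I \<in> models_at G i \<Longrightarrow> least_rank G I \<le> enat i"
  using models_at_interps by (force simp: least_rank_def intro: Least_le)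

lemma least_rank_models_at:
  assumes "I \<in> interps G" "least_rank G I = enat i"
  shows "I \<in> models_at G i"
  using assms by (auto simp: least_rank_def split: if_splits intro: LeastI)

lemma fin_interps_least_rank:
  "I \<in> fin_interps G (least_rank G) \<longleftrightarrow> (\<exists>i. I \<in> models_at G i)"
  using models_at_interps by (force simp: fin_interps_def least_rank_def)

section \<open>The levels of the ranking and their models\<close>

locale defeasible_graph =
  fixes G :: "('u, 'p, 't) statement set"
  assumes graph: "is_defeasible_graph G"
begin

lemma D_seq_subset: "D_seq G i \<subseteq> def_part G"
  by (induction i) auto

lemma D_seq_form:
  assumes "Defeasible (a, e, b) \<in> D_seq G i"
  shows "e \<in> {SC, SP}" "a \<notin> rho_df" "b \<notin> rho_df"
proof -
  have "is_defeasible_triple (Defeasible (a, e, b))"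
    using assms D_seq_subset graph unfolding is_defeasible_graph_def by blast
  then show "e \<in> {SC, SP}" "a \<notin> rho_df" "b \<notin> rho_df" by simp_all
qed

lemma D_seq_Suc_iff:
  "Defeasible (a, e, b) \<in> D_seq G (Suc i) \<longleftrightarrow>
   Defeasible (a, e, b) \<in> D_seq G i \<and> derives (level G i) (a, bot_of e, a)"
  using D_seq_form[of a e b i] by (auto simp: level_def)

lemma D_seq_antimono:
  assumes "i \<le> j"
  shows "D_seq G j \<subseteq> D_seq G i"
proof -
  have "D_seq G (Suc i) \<subseteq> D_seq G i" for i by auto
  then show ?thesis using assms by (rule lift_Suc_antimono_le)
qed

lemma level_triples: "\<tau> \<in> level G i \<Longrightarrow> is_triple \<tau>"
  using graph D_seq_form[of _ _ _ i]
  by (cases \<tau>) (fastforce simp: level_def strictify_def is_defeasible_graph_def is_graph_def is_triple_def)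

lemma strict_graph_graph: "is_graph (strict_graph G)"
proof -
  have "strict_graph G = level G 0" by (simp add: strict_graph_def level_def)
  then have "\<forall>\<tau> \<in> strict_graph G. is_triple \<tau>" using level_triples by simp
  moreover have "strictify (def_part G) \<subseteq>
      (\<lambda>\<delta>. case \<delta> of Strict \<tau> \<Rightarrow> \<tau> | Defeasible \<tau> \<Rightarrow> \<tau>) ` def_part G"
    by (force simp: strictify_def)
  then have "finite (strictify (def_part G))"
    using graph finite_surj by (fastforce simp: is_defeasible_graph_def)
  ultimately show ?thesis
    using graph by (simp add: is_graph_def strict_graph_def is_defeasible_graph_def)
qed

sublocale level: subgraph "level G i" G for i
proof
  show "\<forall>\<sigma> \<in> level G i. is_triple \<sigma>" using level_triples by blast
  show "level G i \<subseteq> strict_graph G"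
    using D_seq_subset[of i] by (auto simp: level_def strict_graph_def strictify_def)
qed (rule strict_graph_graph)

lemma models_at_weak:
  assumes "I \<in> models_at G i" "\<tau> \<in> level G i"
  shows "weakly_satisfies I \<tau>"
  using assms by (cases \<tau>) (auto simp: models_at_def level_def strictify_def weakly_satisfies_def)

lemma models_at_sound:
  assumes "I \<in> models_at G i" "derives (level G i) \<tau>"
  shows "satisfies I {}" "sound_in I \<tau>"
proof -
  obtain \<sigma> where "\<sigma> \<in> level G i" using derives_nonempty[OF assms(2)] by blast
  then have "weakly_satisfies I \<sigma>" by (rule models_at_weak[OF assms(1)])
  then show st: "satisfies I {}"
    by (cases \<sigma>) (auto simp: weakly_satisfies_def satisfies_singleton)
  have "uni (level G i) \<subseteq> voc I"
    using level.uni_sub assms(1) by (auto simp: models_at_def interps_def is_interp_def)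
  then show "sound_in I \<tau>"
    using level.derives_sound[OF assms(2) models_at_weak[OF assms(1)] st] by blast
qed

lemma canon_models_at: "canon G (level G i) \<in> models_at G i"
  using level.canon_interp level.canon_satisfies
  by (auto simp: models_at_def weakly_satisfies_def level_def strictify_def)

text \<open>For equal arguments \<open>sound_in\<close> also forces the term to denote a class or
  property, so soundness gives the disjointness outright. The canonical interpretation refutes what
  is not derivable.\<close>

lemma derives_bot_iff:
  assumes b: "b \<in> {BOTC, BOTP}"
  shows "derives (level G i) (a, b, a) \<longleftrightarrow> (\<forall>I \<in> models_at G i. satisfies I {(a, b, a)})"
proof
  assume d: "derives (level G i) (a, b, a)"
  show "\<forall>I \<in> models_at G i. satisfies I {(a, b, a)}"
  proof
    fix I assume "I \<in> models_at G i"
    note I = models_at_sound[OF this d]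
    have "b \<in> rho_df" using b by (auto simp: rho_df_def)
    then have "b \<in> voc I" "den I b \<in> dP I" using satisfies_empty(1,2)[OF I(1)] by auto
    then show "satisfies I {(a, b, a)}" using I b by (auto simp: satisfies_singleton)
  qed
qed (use canon_models_at level.canon_complete(2) b in blast)

lemma bot_of_bot: "e \<in> {SC, SP} \<Longrightarrow> bot_of e \<in> {BOTC, BOTP}"
  by auto

lemma models_at_mono: "i \<le> j \<Longrightarrow> models_at G i \<subseteq> models_at G j"
  using D_seq_antimono unfolding models_at_def by blast

text \<open>A triple still present at stage \<open>j\<close> survived the step from \<open>i\<close>
  to \<open>Suc i\<close>, which requires its subject to be exceptional at level
  \<open>i\<close>.\<close>

lemma D_seq_exceptional:
  assumes "Defeasible (a, e, b) \<in> D_seq G j" "i < j" "I \<in> models_at G i"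
  shows "satisfies I {(a, bot_of e, a)}"
proof -
  have "Defeasible (a, e, b) \<in> D_seq G (Suc i)" using assms D_seq_antimono[of "Suc i" j] by auto
  then have "derives (level G i) (a, bot_of e, a)" by (simp add: D_seq_Suc_iff del: D_seq.simps)
  moreover have "bot_of e \<in> {BOTC, BOTP}" using assms(1) D_seq_form(1) bot_of_bot by blast
  ultimately show ?thesis using assms(3) by (simp add: derives_bot_iff)
qed

section \<open>Minimal interpretations under the least rank\<close>

lemma bot_min_least_rank_empty:
  assumes "b \<in> {BOTC, BOTP}" "\<And>i. derives (level G i) (t, b, t)"
  shows "bot_min G b t (least_rank G) = {}"
  using assms by (auto simp: bot_min_def fin_interps_least_rank derives_bot_iff)

text \<open>An interpretation of rank \<open>i < j\<close> lies in \<open>models_at G i\<close>,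
  where \<open>t\<close> is impossible by \<open>before\<close>; so those that keep \<open>t\<close>
  possible have rank at least \<open>j\<close>. The canonical interpretation of level
  \<open>j\<close> attains this bound.\<close>

lemma bot_min_least_rank:
  assumes b: "b \<in> {BOTC, BOTP}"
    and before: "\<And>i. i < j \<Longrightarrow> derives (level G i) (t, b, t)"
    and j: "\<not> derives (level G j) (t, b, t)"
  shows "bot_min G b t (least_rank G) = {I \<in> models_at G j. \<not> satisfies I {(t, b, t)}}"
proof -
  have ge: "enat j \<le> least_rank G I"
    if "I \<in> interps G" "\<not> satisfies I {(t, b, t)}" for I
  proof (rule ccontr)
    assume less: "\<not> enat j \<le> least_rank G I"
    then obtain i where i: "least_rank G I = enat i" by (cases "least_rank G I") auto
    then have "i < j" using less by simp
    then show False
      using before least_rank_models_at[OF that(1) i] that(2) b by (auto simp: derives_bot_iff)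
  qed
  have canon: "canon G (level G j) \<in> models_at G j"
    "\<not> satisfies (canon G (level G j)) {(t, b, t)}"
    using canon_models_at level.canon_complete(2)[of j t b t] b j by auto
  show ?thesis
  proof (intro equalityI subsetI)
    fix I assume "I \<in> bot_min G b t (least_rank G)"
    then have I: "I \<in> interps G" "\<not> satisfies I {(t, b, t)}"
      and "least_rank G I \<le> least_rank G (canon G (level G j))"
      using canon fin_interps_least_rank unfolding bot_min_def by (auto simp: fin_interps_def)
    then have "least_rank G I \<le> enat j" using least_rank_le[OF canon(1)] by simp
    then have "least_rank G I = enat j" using ge[OF I] by simp
    then show "I \<in> {I \<in> models_at G j. \<not> satisfies I {(t, b, t)}}"
      using least_rank_models_at I by blast
  next
    fix I assume I: "I \<in> {I \<in> models_at G j. \<not> satisfies I {(t, b, t)}}"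
    have "least_rank G I \<le> least_rank G J"
      if "J \<in> fin_interps G (least_rank G)" "\<not> satisfies J {(t, b, t)}" for J
      using least_rank_le[of I G j] I ge[of J] that by (force simp: fin_interps_def)
    then show "I \<in> bot_min G b t (least_rank G)"
      using I fin_interps_least_rank unfolding bot_min_def by blast
  qed
qed

section \<open>The least rank has no gaps, gives a ranked model, and is minimal\<close>

text \<open>If rank \<open>k\<close> were skipped, \<open>models_at G k\<close> would equal the set
  one stage earlier, where all subjects of \<open>D_seq G k\<close> are impossible. Then they are
  exceptional at level \<open>k\<close> too, so the stages stop shrinking at \<open>k\<close> and
  rank \<open>Suc k\<close> cannot occur.\<close>

lemma least_rank_step:
  assumes "I \<in> interps G" "least_rank G I = enat (Suc k)"
  shows "\<exists>J \<in> interps G. least_rank G J = enat k"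
proof (rule ccontr)
  assume none: "\<not> (\<exists>J \<in> interps G. least_rank G J = enat k)"
  have no_new: "\<exists>i < k. J \<in> models_at G i" if J: "J \<in> models_at G k" for J
  proof -
    have "least_rank G J \<le> enat k" by (rule least_rank_le[OF J])
    then obtain i where i: "least_rank G J = enat i" "i \<le> k" by (cases "least_rank G J") auto
    moreover have "J \<in> interps G" using J models_at_interps by blast
    ultimately show ?thesis using none least_rank_models_at le_neq_implies_less by blast
  qed
  \<comment> \<open>The canonical interpretation makes \<open>models_at G k\<close> nonempty, which
    rules out \<open>k = 0\<close>.\<close>
  obtain m where k: "k = Suc m" using no_new[OF canon_models_at] by (cases k) auto
  have same: "models_at G k \<subseteq> models_at G m"
    using no_new models_at_mono unfolding k by (meson less_Suc_eq_le subsetD subsetI)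
  have "D_seq G k \<subseteq> D_seq G (Suc k)"
  proof
    fix \<delta> assume \<delta>: "\<delta> \<in> D_seq G k"
    then obtain \<tau> where "\<delta> = Defeasible \<tau>" using D_seq_subset unfolding def_part_def by blast
    then obtain a e b where abe: "\<delta> = Defeasible (a, e, b)" by (cases \<tau>) auto
    have "e \<in> {SC, SP}" using \<delta> unfolding abe by (rule D_seq_form)
    then have "derives (level G k) (a, bot_of e, a)"
      using derives_bot_iff[OF bot_of_bot] D_seq_exceptional[OF \<delta>[unfolded abe], of m] same k by blast
    then show "\<delta> \<in> D_seq G (Suc k)" using \<delta> unfolding abe D_seq_Suc_iff by blast
  qed
  then have "models_at G (Suc k) \<subseteq> models_at G k" unfolding models_at_def by blast
  then have "I \<in> models_at G k" using least_rank_models_at[OF assms] by blast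
  then show False using least_rank_le assms(2) by fastforce
qed

lemma least_rank_ranked_interp: "is_ranked_interp G (least_rank G)"
  unfolding is_ranked_interp_def
proof (intro conjI allI impI)
  show "least_rank G \<in> extensional (interps G)" by (simp add: least_rank_def)
  show "\<exists>I \<in> interps G. least_rank G I = 0"
    using least_rank_le[OF canon_models_at[of 0]] level.canon_interp
    by (auto simp: zero_enat_def[symmetric])
  fix i :: nat assume "0 < i" "\<exists>I \<in> interps G. least_rank G I = enat i"
  then show "\<exists>I \<in> interps G. least_rank G I = enat (i - 1)"
    using least_rank_step by (cases i) auto
qed

text \<open>A defeasible triple whose subject is exceptional at every level holds vacuously.
  Otherwise it survives up to the first level \<open>j\<close> at which its subject is not
  exceptional, and the minimal interpretations weakly satisfy it while keeping the subject
  possible.\<close>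

lemma least_rank_model: "is_ranked_model G (least_rank G)"
  unfolding is_ranked_model_def
proof (intro conjI ballI)
  show "is_ranked_interp G (least_rank G)" by (rule least_rank_ranked_interp)
  fix \<sigma> assume \<sigma>: "\<sigma> \<in> G"
  show "ranked_satisfies G (least_rank G) \<sigma>"
  proof (cases \<sigma>)
    case (Strict \<tau>)
    have "satisfies I {\<tau>}" if "I \<in> fin_interps G (least_rank G)" for I
    proof -
      obtain i where "I \<in> models_at G i" using \<open>I \<in> _\<close> by (auto simp: fin_interps_least_rank)
      then show ?thesis using \<sigma> Strict unfolding models_at_def str_part_def by blast
    qed
    then show ?thesis using Strict by simp
  next
    case (Defeasible \<tau>)
    then obtain a e b where abe: "\<sigma> = Defeasible (a, e, b)" by (cases \<tau>) auto
    then have D0: "Defeasible (a, e, b) \<in> D_seq G 0" using \<sigma> by (auto simp: def_part_def)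
    then have e: "e \<in> {SC, SP}" by (rule D_seq_form)
    show ?thesis
    proof (cases "\<forall>i. derives (level G i) (a, bot_of e, a)")
      case True
      then show ?thesis
        using bot_min_least_rank_empty[OF bot_of_bot[OF e]] ranked_satisfies_bot_min[OF e]
        unfolding abe by blast
    next
      case False
      then obtain j where j: "\<not> derives (level G j) (a, bot_of e, a)"
        and before: "\<And>i. i < j \<Longrightarrow> derives (level G i) (a, bot_of e, a)"
        using exists_least_iff[of "\<lambda>j. \<not> derives (level G j) (a, bot_of e, a)"] by blast
      have Dj: "Defeasible (a, e, b) \<in> D_seq G i" if "i \<le> j" for i
        using that
      proof (induction i)
        case (Suc i)
        then show ?case unfolding D_seq_Suc_iff using before by simp
      qed (rule D0)
      have "bot_min G (bot_of e) a (least_rank G) =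
          {I \<in> models_at G j. \<not> satisfies I {(a, bot_of e, a)}}"
        by (rule bot_min_least_rank[OF bot_of_bot[OF e] _ j]) (rule before)
      then have "satisfies I {(a, e, b)}" if "I \<in> bot_min G (bot_of e) a (least_rank G)" for I
        using that Dj[of j] by (auto simp: models_at_def weakly_satisfies_def)
      then show ?thesis unfolding abe ranked_satisfies_bot_min[OF e] by blast
    qed
  qed
qed

text \<open>By strong induction, an interpretation of finite rank \<open>k\<close> under
  \<open>r\<close> lies in \<open>models_at G k\<close>. If it violated a triple of
  \<open>D_seq G k\<close> weakly, then all interpretations of lower rank would make the subject
  impossible by induction, so it would be minimal for that subject and the ranked model would force
  the triple.\<close>

lemma least_rank_le_ranked_model:
  assumes r: "is_ranked_model G r"
  shows "ranking_le G (least_rank G) r"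
proof -
  have "I \<in> models_at G k" if "I \<in> interps G" "r I = enat k" for I k
    using that
  proof (induction k arbitrary: I rule: less_induct)
    case (less k)
    have fin: "I \<in> fin_interps G r" using less.prems by (simp add: fin_interps_def)
    have "weakly_satisfies I (a, e, b)" if D: "Defeasible (a, e, b) \<in> D_seq G k" for a e b
    proof (rule ccontr)
      assume nw: "\<not> weakly_satisfies I (a, e, b)"
      have e: "e \<in> {SC, SP}" using D by (rule D_seq_form)
      have "r I \<le> r J" if J: "J \<in> fin_interps G r" "\<not> satisfies J {(a, bot_of e, a)}" for J
      proof (rule ccontr)
        assume lt: "\<not> r I \<le> r J"
        then obtain i where i: "r J = enat i" "i < k" using less.prems(2) by (cases "r J") auto
        then have "J \<in> models_at G i" using less.IH J(1) by (auto simp: fin_interps_def)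
        then show False using D_seq_exceptional[OF D i(2)] J(2) by blast
      qed
      then have "I \<in> bot_min G (bot_of e) a r"
        using fin nw e by (auto simp: bot_min_def weakly_satisfies_def)
      moreover have "Defeasible (a, e, b) \<in> G" using D D_seq_subset by (auto simp: def_part_def)
      ultimately have "satisfies I {(a, e, b)}"
        using r ranked_satisfies_bot_min[OF e] unfolding is_ranked_model_def by blast
      then show False using nw by (simp add: weakly_satisfies_def)
    qed
    moreover have "\<forall>\<tau> \<in> str_part G. satisfies I {\<tau>}"
      using r fin by (auto simp: is_ranked_model_def str_part_def)
    ultimately show ?case using less.prems(1) by (auto simp: models_at_def)
  qed
  then have "least_rank G I \<le> r I" if "I \<in> interps G" for I
    using that least_rank_le[of I G] by (cases "r I") auto
  then show ?thesis by (simp add: ranking_le_def)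
qed

text \<open>A ranked model below all others is the only minimal one; extensionality turns agreement
  on \<open>interps G\<close> into equality of functions.\<close>

lemma min_ranked_model_eq: "min_ranked_model G = least_rank G"
  unfolding min_ranked_model_def
proof (rule the_equality)
  show "is_minimal_ranked_model G (least_rank G)"
    using least_rank_model least_rank_le_ranked_model by (auto simp: is_minimal_ranked_model_def)
  fix r assume "is_minimal_ranked_model G r"
  then have r: "is_ranked_model G r" and "ranking_le G r (least_rank G)"
    using least_rank_model least_rank_le_ranked_model by (auto simp: is_minimal_ranked_model_def)
  then have "r I = least_rank G I" if "I \<in> interps G" for I
    using least_rank_le_ranked_model[OF r] that by (auto simp: ranking_le_def intro: order.antisym)
  moreover have "r \<in> extensional (interps G)"
    using r by (simp add: is_ranked_model_def is_ranked_interp_def)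
  ultimately show "r = least_rank G"
    by (auto intro!: extensionalityI[of _ "interps G"] simp: least_rank_def)
qed


section \<open>The decision procedure\<close>

lemma finite_def_part: "finite (def_part G)"
  using graph by (simp add: is_defeasible_graph_def)

lemma D_seq_stable_from:
  assumes "D_seq G n = D_seq G (Suc n)" "n \<le> i"
  shows "D_seq G i = D_seq G n"
  using assms(2)
proof (induction i rule: dec_induct)
  case (step i)
  then have "D_seq G (Suc i) = D_seq G (Suc n)" by simp
  then show ?case by (simp only: assms(1)[symmetric])
qed simp

lemma D_seq_stabilizes: "\<exists>n. D_seq G n = D_seq G (Suc n)"
proof (rule ccontr)
  assume "\<nexists>n. D_seq G n = D_seq G (Suc n)"
  then have less: "D_seq G (Suc n) \<subset> D_seq G n" for n
    using D_seq_antimono[of n "Suc n"] by (metis le_add2 plus_1_eq_Suc psubsetI)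
  have drop: "card (D_seq G (Suc n)) < card (D_seq G n)" for n
    using finite_subset[OF D_seq_subset finite_def_part] less by (rule psubset_card_mono)
  have "card (D_seq G n) + n \<le> card (D_seq G 0)" for n
  proof (induction n)
    case (Suc n)
    then show ?case using drop[of n] by linarith
  qed simp
  from this[of "Suc (card (D_seq G 0))"] show False by simp
qed

text \<open>Only \<open>r2a\<close> concludes subproperty triples, as \<open>r2b\<close> yields
  non-reserved predicates. Along such a chain each subject stays non-exceptional, since
  impossibility of the middle term would pass down to \<open>s\<close>; and a triple of
  \<open>D_seq G (Suc j)\<close> has an exceptional subject, so none is used.\<close>

lemma derives_sp_current_level:
  assumes "derives (level G j) \<tau>" "\<tau> = (s, SP, t)" "\<not> derives (level G j) (s, BOTP, s)"
  shows "derives (str_part G \<union> strictify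
    {Defeasible (a, SP, b) | a b. Defeasible (a, SP, b) \<in> D_seq G j - D_seq G (Suc j)}) (s, SP, t)"
  using assms
proof (induction arbitrary: s t rule: derives.induct)
  case (base \<tau>)
  then show ?case
    using D_seq_Suc_iff[of s SP t j]
    by (intro derives.base) (auto simp: level_def strictify_def simp del: D_seq.simps)
next
  case (step T \<tau>)
  from step.hyps(1) show ?case
  proof cases
    case (r2a A B C)
    then have AB: "derives (level G j) (A, SP, B)" "derives (level G j) (B, SP, C)"
      using step.IH by auto
    have A: "A = s" "C = t" using r2a step.prems by auto
    then have "\<not> derives (level G j) (B, BOTP, B)"
      using level.botp_self_down[OF _ AB(1)] step.prems(2) by blast
    then show ?thesis
      using step.IH step.prems r2a A step.hyps(2)
      by (intro derives.step[OF rho_rule.r2a[of A B C, unfolded A]]) auto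
  next
    case (r2b D E X Y)
    then have "derives (level G j) (D, SP, E)" using step.IH by auto
    then have "E \<notin> rho_df" by (rule level.derives_not_reserved)
    then show ?thesis using r2b step.prems by (auto simp: rho_df_def)
  qed (use step.prems in auto)
qed

text \<open>Where \<open>p\<close> is possible, weak satisfaction of \<open>(p, SP, q)\<close> is
  satisfaction, which gives soundness. Conversely, the canonical interpretation of level
  \<open>j\<close> keeps \<open>p\<close> possible and satisfies only derivable subproperty
  triples.\<close>

lemma min_entails_sp_iff:
  assumes before: "\<And>i. i < j \<Longrightarrow> derives (level G i) (p, BOTP, p)"
    and j: "\<not> derives (level G j) (p, BOTP, p)"
  shows "min_entails G (Defeasible (p, SP, q)) \<longleftrightarrow> derives (level G j) (p, SP, q)"
proof -
  have "min_entails G (Defeasible (p, SP, q)) \<longleftrightarrow>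
      (\<forall>I \<in> bot_min G BOTP p (least_rank G). satisfies I {(p, SP, q)})"
    using ranked_satisfies_bot_min[of SP] by (simp add: min_entails_def min_ranked_model_eq)
  also have "\<dots> \<longleftrightarrow>
      (\<forall>I \<in> models_at G j. \<not> satisfies I {(p, BOTP, p)} \<longrightarrow> satisfies I {(p, SP, q)})"
    using bot_min_least_rank[of BOTP j p] before j by auto
  also have "\<dots> \<longleftrightarrow> derives (level G j) (p, SP, q)"
  proof
    assume "derives (level G j) (p, SP, q)"
    then have "sound_in I (p, SP, q)" if "I \<in> models_at G j" for I
      using models_at_sound(2) that by blast
    then show "\<forall>I \<in> models_at G j. \<not> satisfies I {(p, BOTP, p)} \<longrightarrow> satisfies I {(p, SP, q)}"
      by (simp add: weakly_satisfies_def) blast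
  qed (use canon_models_at level.canon_complete j in blast)
  finally show ?thesis .
qed

text \<open>Eliminates the list and the bound \<open>n\<close>. The premises on the right determine
  \<open>j\<close> as the first non-exceptional level, so the quantifier ranges over at most one
  index.\<close>

lemma DefMinEntailmentP_iff:
  "DefMinEntailmentP G (Ranking G) p q \<longleftrightarrow>
    (\<forall>j. (\<forall>i < j. derives (level G i) (p, BOTP, p)) \<longrightarrow> \<not> derives (level G j) (p, BOTP, p) \<longrightarrow>
      derives (level G j) (p, SP, q))"
proof -
  define n where "n = (LEAST n. D_seq G n = D_seq G (Suc n))"
  have n: "D_seq G n = D_seq G (Suc n)"
    unfolding n_def by (rule LeastI_ex[OF D_seq_stabilizes])
  have R: "Ranking G = map (D_seq G) [0..<Suc n] @ [D_seq G n]"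
    by (simp add: Ranking_def n_def Let_def)
  have len: "length (Ranking G) - 2 = n" unfolding R by simp
  \<comment> \<open>The bound reaches \<open>Suc n\<close> because the procedure reads entry
    \<open>Suc j\<close> for \<open>j\<close> up to \<open>n\<close>; the last entry is
    \<open>D_seq G n\<close>, which equals \<open>D_seq G (Suc n)\<close>.\<close>
  have nth: "Ranking G ! i = D_seq G i" if "i \<le> Suc n" for i
    using that n unfolding R
    by (cases "i = Suc n") (auto simp: nth_append simp del: D_seq.simps upt_Suc)
  define E where "E i \<longleftrightarrow> derives (level G i) (p, BOTP, p)" for i
  have exc: "derives (str_part G \<union> strictify (Ranking G ! i)) (p, BOTP, p) \<longleftrightarrow> E i" if "i \<le> n" for i
    using that nth by (simp add: E_def level_def)
  \<comment> \<open>Levels beyond \<open>n\<close> repeat level \<open>n\<close>, so the bounded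
    search misses no first non-exceptional level.\<close>
  have stable: "E i \<longleftrightarrow> E n" if "n \<le> i" for i
    using D_seq_stable_from[OF n that] by (simp add: E_def level_def)
  show ?thesis
  proof (cases "\<forall>i \<le> n. E i")
    case True
    then have "E i" for i using stable[of i] by (cases "i \<le> n") auto
    then show ?thesis
      using True exc by (simp add: DefMinEntailmentP_def len Let_def E_def)
  next
    case False
    define j where "j = (LEAST j. j \<le> n \<and> \<not> E j)"
    have j: "j \<le> n" "\<not> E j" using LeastI_ex[of "\<lambda>j. j \<le> n \<and> \<not> E j"] False unfolding j_def by auto
    have before: "E i" if "i < j" for i
      using not_less_Least[of i "\<lambda>j. j \<le> n \<and> \<not> E j"] that j(1) unfolding j_def[symmetric] by auto
    have "(LEAST j. j \<le> n \<and> \<not> derives (str_part G \<union> strictify (Ranking G ! j)) (p, BOTP, p)) = j"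
      unfolding j_def using exc by (metis (no_types, lifting))
    moreover have "\<not> (\<forall>i \<le> n. derives (str_part G \<union> strictify (Ranking G ! i)) (p, BOTP, p))"
      using False exc by blast
    ultimately have "DefMinEntailmentP G (Ranking G) p q \<longleftrightarrow>
        derives (str_part G \<union> strictify {Defeasible (a, SP, b) | a b.
          Defeasible (a, SP, b) \<in> Ranking G ! j - Ranking G ! Suc j}) (p, SP, q)"
      unfolding DefMinEntailmentP_def len Let_def by (simp only: if_False)
    also have "\<dots> \<longleftrightarrow>
        derives (str_part G \<union> strictify {Defeasible (a, SP, b) | a b.
          Defeasible (a, SP, b) \<in> D_seq G j - D_seq G (Suc j)}) (p, SP, q)" (is "_ \<longleftrightarrow> derives ?K _")
      using j(1) nth[of j] nth[of "Suc j"] by (simp only: le_SucI Suc_le_mono)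
    also have "\<dots> \<longleftrightarrow> derives (level G j) (p, SP, q)"
    proof
      assume "derives (level G j) (p, SP, q)"
      then show "derives ?K (p, SP, q)" using derives_sp_current_level j(2) unfolding E_def by blast
    next
      have "?K \<subseteq> level G j" by (auto simp: level_def strictify_def)
      then show "derives ?K (p, SP, q) \<Longrightarrow> derives (level G j) (p, SP, q)"
        by (rule derives_mono[rotated])
    qed
    \<comment> \<open>No other index meets both premises: a smaller one is exceptional, and a larger
      one has the non-exceptional \<open>j\<close> below it.\<close>
    finally show ?thesis
      using before j(2) unfolding E_def by (metis linorder_neqE_nat)
  qed
qed

end

theorem theorem3p29:
  fixes G :: "('u, 'p, 't) statement set"
    and p q :: "('u, 'p, 't) rdf_term"
  assumes "is_defeasible_graph G"
    and "is_defeasible_triple (Defeasible (p, SP, q))"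
  shows "min_entails G (Defeasible (p, SP, q)) \<longleftrightarrow> DefMinEntailmentP G (Ranking G) p q"
proof -
  interpret defeasible_graph G by unfold_locales (rule assms(1))
  show ?thesis
  proof (cases "\<forall>i. derives (level G i) (p, BOTP, p)")
    case True
    \<comment> \<open>No interpretation of finite rank keeps \<open>p\<close> possible, so there are
      no minimal ones and entailment is vacuous, as is the criterion for the procedure.\<close>
    then have "min_entails G (Defeasible (p, SP, q))"
      using bot_min_least_rank_empty[of BOTP p]
      by (simp add: min_entails_def min_ranked_model_eq ranked_satisfies_bot_min
        del: ranked_satisfies.simps)
    then show ?thesis using True by (simp add: DefMinEntailmentP_iff)
  next
    case False
    then obtain j where "\<not> derives (level G j) (p, BOTP, p)"
      "\<And>i. i < j \<Longrightarrow> derives (level G i) (p, BOTP, p)"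
      using exists_least_iff[of "\<lambda>j. \<not> derives (level G j) (p, BOTP, p)"] by blast
    then show ?thesis
      using min_entails_sp_iff[of j p q] unfolding DefMinEntailmentP_iff
      by (metis linorder_neqE_nat)
  qed
qed

end
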